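(* Let $(X,d,p)$ be a pointed metric space and let $E=S_p(X)=\{d(x,p):x\in X\}\subseteq[0,\infty)$. The family $\mathbf{\Omega_p^X(n)}$ of all pretangent spaces to $X$ at $p$ with normal scaling sequences is uniformly bounded if and only if $E$ is completely strongly porous at $0$ (i.e. $E\in\mathbf{CSP}$). If $\mathbf{\Omega_p^X(n)}$ is uniformly bounded and $p$ is an accumulation point of $X$, then $$R^{*}(\mathbf{\Omega_p^X(n)})=M(\tilde L),$$ where $\tilde L$ is a universal element of $\tilde I_E^d$.
   Context: **Pretangent spaces.** Let $(X,d,p)$ be a metric space with a marked point $p\in X$. A scaling sequence is a sequence $\tilde r=(r_n)_{n\in\mathbb N}$ of positive reals tending to $0$. Let $\tilde X$ be the set of all sequences of points of $X$. Sequences $\tilde x=(x_n),\tilde y=(y_n)\in\tilde X$ are mutually stable w.r.t. $\tilde r$ if the finite limit $\tilde d_{\tilde r}(\tilde x,\tilde y)=\lim_{n\to\infty} d(x_n,y_n)/r_n$ exists. A family $\tilde F\subseteq\tilde X$ is self-stable if any two of its members are mutually stable, and maximal self-stable if moreover every $\tilde z\in\tilde X\setminus\tilde F$ fails to be mutually stable with some member of $\tilde F$. Let $\tilde p=(p,p,\dots)$. If $\tilde X_{p,\tilde r}$ is a maximal self-stable family (w.r.t. $\tilde r$) containing $\tilde p$, then $\tilde d_{\tilde r}$ is a pseudometric on it; its metric identification (quotient by $\tilde d_{\tilde r}=0$) is a metric space $(\Omega_{p,\tilde r}^X,\rho)$ with marked point $\alpha$ the class of $\tilde p$, called a pretangent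 space to $X$ at $p$ w.r.t. $\tilde r$. (Different choices of the maximal self-stable family may give different pretangent spaces.) **Normal scaling sequences.** A real sequence $(\tau_n)$ is almost decreasing if $\tau_{n+1}\le\tau_n$ for all sufficiently large $n$. If $p$ is an accumulation point of $X$, a scaling sequence $(r_n)$ is normal if there is $(x_n)\in\tilde X$ such that $(d(x_n,p))$ is almost decreasing and $\lim_{n\to\infty}d(x_n,p)/r_n=1$. If $p$ is isolated there are no normal scaling sequences. $\mathbf{\Omega_p^X(n)}$ is the set of all pretangent spaces $\Omega_{p,\tilde r}^X$ (over all maximal self-stable families containing $\tilde p$) with $\tilde r$ normal. **Uniform boundedness.** For a family $\mathfrak F=\{(X_i,d_i,p_i):i\in I\}$ of pointed metric spaces, $\rho^*(X_i)=\sup_{x\in X_i}d_i(x,p_i)$ and $R^*(\mathfrak F)=\sup_{i\in I}\rho^*(X_i)$. $\mathfrak F$ is uniformly bounded if there is $c>0$ with $\mathrm{diam}\,X_i<c$ for all $i$ (equivalently $R^*(\mathfrak F)<\infty$). The empty family counts as uniformly bounded. **Completely strongly porous sets.** Let $E\subseteq\mathbb R^+=[0,\infty)$. $\tilde E_0^d$ is the set of almost decreasing sequences $(\tau_n)$ with $\tau_n\in E\setminus\{0\}$ for all $n$ and $\tau_n\to0$. $\tilde I_E^d$ is the set of sequences of open intervals $\{(a_n,b_n)\}_{n\in\mathbb N}$ in $\mathbb R^+$ such that each $(a_n,b_n)$ is a connected component of $\mathrm{Int}(\mathbb R^+\setminus E)$ (that is, $(a_n,b_n)\cap E=\varnothing$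 and every strictly larger open interval $(a,b)\supseteq(a_n,b_n)$ meets $E$), $(a_n)$ is almost decreasing, $a_n\to0$, and $(b_n-a_n)/b_n\to1$. For sequences of positive numbers, $\tilde a\asymp\tilde\gamma$ means there are constants $c_1,c_2>0$ with $c_1a_n<\gamma_n<c_2a_n$ for all $n$. For $\tilde\tau\in\tilde E_0^d$, $E$ is $\tilde\tau$-strongly porous at $0$ if there is $\{(a_n,b_n)\}\in\tilde I_E^d$ with $\tilde\tau\asymp\tilde a=(a_n)$. $E$ is completely strongly porous at $0$, written $E\in\mathbf{CSP}$, if $E$ is $\tilde\tau$-strongly porous at $0$ for every $\tilde\tau\in\tilde E_0^d$. **Universal elements.** For $\tilde A=\{(a_n,b_n)\},\tilde L=\{(l_n,m_n)\}\in\tilde I_E^d$ write $\tilde A\preceq\tilde L$ if there are $N_1\in\mathbb N$ and $f:\{N_1,N_1+1,\dots\}\to\mathbb N$ with $a_n=l_{f(n)}$ for all $n\ge N_1$. $\tilde L$ is universal if $\tilde B\preceq\tilde L$ for every $\tilde B\in\tilde I_E^d$. For universal $\tilde L$, $M(\tilde L)=\limsup_{n\to\infty} l_n/m_{n+1}$. *)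

theory Defs
  imports "HOL-Analysis.Analysis"
begin

section \<open>Pretangent spaces\<close>

text \<open>A metric space is given by a carrier \<open>X\<close> and a distance \<open>d\<close> with \<^term>\<open>Metric_space X d\<close>.\<close>

definition scaling_seq :: "(nat \<Rightarrow> real) \<Rightarrow> bool" where
  "scaling_seq r \<longleftrightarrow> (\<forall>n. 0 < r n) \<and> r \<longlonglongrightarrow> 0"

definition point_seqs :: "'a set \<Rightarrow> (nat \<Rightarrow> 'a) set" where
  "point_seqs X = {x. \<forall>n. x n \<in> X}"

definition mutually_stable ::
    "('a \<Rightarrow> 'a \<Rightarrow> real) \<Rightarrow> (nat \<Rightarrow> real) \<Rightarrow> (nat \<Rightarrow> 'a) \<Rightarrow> (nat \<Rightarrow> 'a) \<Rightarrow> bool" where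
  "mutually_stable d r x y \<longleftrightarrow> convergent (\<lambda>n. d (x n) (y n) / r n)"

definition scaled_dist ::
    "('a \<Rightarrow> 'a \<Rightarrow> real) \<Rightarrow> (nat \<Rightarrow> real) \<Rightarrow> (nat \<Rightarrow> 'a) \<Rightarrow> (nat \<Rightarrow> 'a) \<Rightarrow> real" where
  "scaled_dist d r x y = lim (\<lambda>n. d (x n) (y n) / r n)"

definition self_stable ::
    "'a set \<Rightarrow> ('a \<Rightarrow> 'a \<Rightarrow> real) \<Rightarrow> (nat \<Rightarrow> real) \<Rightarrow> (nat \<Rightarrow> 'a) set \<Rightarrow> bool" where
  "self_stable X d r F \<longleftrightarrow>
     F \<subseteq> point_seqs X \<and> (\<forall>x\<in>F. \<forall>y\<in>F. mutually_stable d r x y)"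

definition maximal_self_stable ::
    "'a set \<Rightarrow> ('a \<Rightarrow> 'a \<Rightarrow> real) \<Rightarrow> (nat \<Rightarrow> real) \<Rightarrow> (nat \<Rightarrow> 'a) set \<Rightarrow> bool" where
  "maximal_self_stable X d r F \<longleftrightarrow>
     self_stable X d r F \<and>
     (\<forall>z \<in> point_seqs X - F. \<exists>x\<in>F. \<not> mutually_stable d r z x)"

text \<open>A pointed metric space is a triple of carrier, distance and marked point; only the values of
  the distance on the carrier matter.\<close>

type_synonym 'b pointed_space = "'b set \<times> ('b \<Rightarrow> 'b \<Rightarrow> real) \<times> 'b"

definition zero_dist_rel ::
    "('a \<Rightarrow> 'a \<Rightarrow> real) \<Rightarrow> (nat \<Rightarrow> real) \<Rightarrow> (nat \<Rightarrow> 'a) set \<Rightarrow> ((nat \<Rightarrow> 'a) \<times> (nat \<Rightarrow> 'a)) set" where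
  "zero_dist_rel d r F = {(x, y). x \<in> F \<and> y \<in> F \<and> scaled_dist d r x y = 0}"

text \<open>On classes of the metric identification, \<^term>\<open>scaled_dist d r\<close> does not depend on the
  representatives, so the set of its values below is a singleton.\<close>

definition quotient_dist ::
    "('a \<Rightarrow> 'a \<Rightarrow> real) \<Rightarrow> (nat \<Rightarrow> real) \<Rightarrow> (nat \<Rightarrow> 'a) set \<Rightarrow> (nat \<Rightarrow> 'a) set \<Rightarrow> real" where
  "quotient_dist d r A B = the_elem (\<Union>x\<in>A. \<Union>y\<in>B. {scaled_dist d r x y})"

definition metric_identification ::
    "('a \<Rightarrow> 'a \<Rightarrow> real) \<Rightarrow> 'a \<Rightarrow> (nat \<Rightarrow> real) \<Rightarrow> (nat \<Rightarrow> 'a) set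
      \<Rightarrow> (nat \<Rightarrow> 'a) set pointed_space" where
  "metric_identification d p r F =
     (F // zero_dist_rel d r F, quotient_dist d r, zero_dist_rel d r F `` {\<lambda>n. p})"

definition almost_decreasing :: "(nat \<Rightarrow> real) \<Rightarrow> bool" where
  "almost_decreasing t \<longleftrightarrow> (\<forall>\<^sub>F n in sequentially. t (Suc n) \<le> t n)"

definition normal_scaling_seq ::
    "'a set \<Rightarrow> ('a \<Rightarrow> 'a \<Rightarrow> real) \<Rightarrow> 'a \<Rightarrow> (nat \<Rightarrow> real) \<Rightarrow> bool" where
  "normal_scaling_seq X d p r \<longleftrightarrow>
     scaling_seq r \<and> p \<in> Metric_space.mtopology X d derived_set_of X \<and>
     (\<exists>x \<in> point_seqs X. almost_decreasing (\<lambda>n. d (x n) p) \<and> (\<lambda>n. d (x n) p / r n) \<longlonglongrightarrow> 1)"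

definition normal_pretangent_spaces ::
    "'a set \<Rightarrow> ('a \<Rightarrow> 'a \<Rightarrow> real) \<Rightarrow> 'a \<Rightarrow> (nat \<Rightarrow> 'a) set pointed_space set" where
  "normal_pretangent_spaces X d p =
     {metric_identification d p r F | r F.
        normal_scaling_seq X d p r \<and> maximal_self_stable X d r F \<and> (\<lambda>n. p) \<in> F}"


section \<open>Uniform boundedness\<close>

text \<open>Diameters and radii may be infinite, hence the extended reals.\<close>

definition space_diameter :: "'b pointed_space \<Rightarrow> ereal" where
  "space_diameter = (\<lambda>(S, e, q). SUP (x, y) \<in> S \<times> S. ereal (e x y))"

definition space_radius :: "'b pointed_space \<Rightarrow> ereal" where
  "space_radius = (\<lambda>(S, e, q). SUP x \<in> S. ereal (e x q))"

definition family_radius :: "'b pointed_space set \<Rightarrow> ereal" where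
  "family_radius \<F> = (SUP T \<in> \<F>. space_radius T)"

definition uniformly_bounded :: "'b pointed_space set \<Rightarrow> bool" where
  "uniformly_bounded \<F> \<longleftrightarrow> (\<exists>c>0. \<forall>T\<in>\<F>. space_diameter T < ereal c)"


section \<open>Completely strongly porous sets\<close>

definition dist_set :: "'a set \<Rightarrow> ('a \<Rightarrow> 'a \<Rightarrow> real) \<Rightarrow> 'a \<Rightarrow> real set" where
  "dist_set X d p = {d x p | x. x \<in> X}"

definition decreasing_seqs :: "real set \<Rightarrow> (nat \<Rightarrow> real) set" where
  "decreasing_seqs E =
     {t. almost_decreasing t \<and> (\<forall>n. t n \<in> E - {0}) \<and> t \<longlonglongrightarrow> 0}"

text \<open>The interval \<open>(a\<^sub>n, b\<^sub>n)\<close> is encoded as the pair \<open>A n\<close> of its endpoints. The interior is taken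
  in the real line; for \<open>0 \<in> E\<close>, as for every distance set, it agrees with the interior relative to
  \<open>{0..}\<close>.\<close>

definition gap_seqs :: "real set \<Rightarrow> (nat \<Rightarrow> real \<times> real) set" where
  "gap_seqs E =
     {A. (\<forall>n. {fst (A n)<..<snd (A n)} \<in> components (interior ({0..} - E))) \<and>
         almost_decreasing (\<lambda>n. fst (A n)) \<and>
         (\<lambda>n. fst (A n)) \<longlonglongrightarrow> 0 \<and>
         (\<lambda>n. (snd (A n) - fst (A n)) / snd (A n)) \<longlonglongrightarrow> 1}"

lemma gap_component_iff:
  fixes a b :: real
  shows "{a<..<b} \<in> components (interior ({0..} - E)) \<longleftrightarrow>
    0 \<le> a \<and> a < b \<and> {a<..<b} \<inter> E = {} \<and>
    (\<forall>a' b'. 0 \<le> a' \<and> {a<..<b} \<subset> {a'<..<b'} \<longrightarrow> {a'<..<b'} \<inter> E \<noteq> {})"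
    (is "?L \<longleftrightarrow> ?R")
proof
  assume L: ?L
  then have ne: "a < b"
    using in_components_nonempty by force
  from L have sub: "{a<..<b} \<subseteq> {0..} - E"
    using in_components_subset interior_subset by blast
  have "0 \<le> a"
  proof (rule ccontr)
    assume "\<not> 0 \<le> a"
    then obtain x where "a < x" "x < min 0 b" using dense[of a "min 0 b"] ne by auto
    then show False using sub by force
  qed
  moreover have "{a'<..<b'} \<inter> E \<noteq> {}"
    if "0 \<le> a'" and ss: "{a<..<b} \<subset> {a'<..<b'}" for a' b'
  proof
    assume "{a'<..<b'} \<inter> E = {}"
    then have "{a'<..<b'} \<subseteq> interior ({0..} - E)"
      using that by (intro interior_maximal) auto
    moreover have "{a<..<b} \<inter> {a'<..<b'} \<noteq> {}"
    proof -
      obtain c where "a < c" "c < b" using dense[OF ne] by blast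
      then have "c \<in> {a<..<b}" by simp
      with ss show ?thesis by blast
    qed
    ultimately have "{a'<..<b'} \<subseteq> {a<..<b}"
      by (intro components_maximal[OF L]) auto
    with ss show False by blast
  qed
  ultimately show ?R using ne sub by auto
next
  assume R: ?R
  let ?U = "interior ({0..} - E)"
  from R have sub: "{a<..<b} \<subseteq> ?U" by (intro interior_maximal) auto
  from R obtain c where c: "a < c" "c < b" using dense[of a b] by blast
  let ?C = "connected_component_set ?U c"
  have CU: "?C \<subseteq> ?U" by (rule connected_component_subset)
  have "?C \<in> components ?U" using c sub by (intro componentsI) auto
  moreover have inC: "{a<..<b} \<subseteq> ?C"
    using c sub by (intro connected_component_maximal) auto
  moreover have "?C \<subseteq> {a<..<b}"
  proof
    fix x assume x: "x \<in> ?C"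
    have "open ?C" by (simp add: open_connected_component)
    then obtain e where e: "e > 0" "ball x e \<subseteq> ?C" using x openE by blast
    have iv: "is_interval ?C" by (simp add: is_interval_connected_1)
    show "x \<in> {a<..<b}"
    proof (rule ccontr)
      assume nx: "x \<notin> {a<..<b}"
      define u v where "u = min a (x - e)" and "v = max b (x + e)"
      have seg: "{u<..<v} \<subseteq> ?C"
      proof
        fix y assume y: "y \<in> {u<..<v}"
        have ord: "y \<in> ?C" if "y1 \<in> ?C" "y2 \<in> ?C" "y1 \<le> y" "y \<le> y2" for y1 y2
          using iv that unfolding is_interval_1 by blast
        have lo: "\<exists>y1\<in>?C. y1 \<le> y"
        proof (cases "y > a")
          case True
          then obtain w where "a < w" "w < min y b" using dense[of a "min y b"] R by auto
          then show ?thesis using inC by (intro bexI[of _ w]) auto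
        next
          case False
          then have "y > x - e" using y u_def by auto
          then have "min y x \<in> ball x e" using e by (auto simp: dist_real_def)
          then show ?thesis using e by (intro bexI[of _ "min y x"]) auto
        qed
        have hi: "\<exists>y2\<in>?C. y \<le> y2"
        proof (cases "y < b")
          case True
          then obtain w where "max a y < w" "w < b" using dense[of "max a y" b] R by auto
          then show ?thesis using inC by (intro bexI[of _ w]) auto
        next
          case False
          then have "y < x + e" using y v_def by auto
          then have "max y x \<in> ball x e" using e by (auto simp: dist_real_def)
          then show ?thesis using e by (intro bexI[of _ "max y x"]) auto
        qed
        show "y \<in> ?C" using lo hi ord by blast
      qed
      have uU: "{u<..<v} \<subseteq> {0..} - E" using seg CU interior_subset by blast
      have "0 \<le> u"
      proof (rule ccontr)
        assume "\<not> 0 \<le> u"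
        moreover have "u < v" using R by (auto simp: u_def v_def)
        ultimately obtain w where "u < w" "w < min 0 v" using dense[of u "min 0 v"] by auto
        then show False using uU by force
      qed
      moreover have "x \<in> {u<..<v}" using e by (auto simp: u_def v_def)
      moreover have "{a<..<b} \<subseteq> {u<..<v}" by (auto simp: u_def v_def)
      ultimately have "{u<..<v} \<inter> E \<noteq> {}" using R nx by blast
      then show False using uU by blast
    qed
  qed
  ultimately show ?L by (metis subset_antisym)
qed

definition seq_asymp :: "(nat \<Rightarrow> real) \<Rightarrow> (nat \<Rightarrow> real) \<Rightarrow> bool" where
  "seq_asymp a g \<longleftrightarrow>
     (\<exists>c\<^sub>1 c\<^sub>2. 0 < c\<^sub>1 \<and> 0 < c\<^sub>2 \<and> (\<forall>n. c\<^sub>1 * a n < g n \<and> g n < c\<^sub>2 * a n))"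

definition strongly_porous_along :: "real set \<Rightarrow> (nat \<Rightarrow> real) \<Rightarrow> bool" where
  "strongly_porous_along E t \<longleftrightarrow> (\<exists>A \<in> gap_seqs E. seq_asymp t (\<lambda>n. fst (A n)))"

definition completely_strongly_porous :: "real set \<Rightarrow> bool" where
  "completely_strongly_porous E \<longleftrightarrow> (\<forall>t \<in> decreasing_seqs E. strongly_porous_along E t)"


section \<open>Universal elements\<close>

definition gap_seq_le :: "(nat \<Rightarrow> real \<times> real) \<Rightarrow> (nat \<Rightarrow> real \<times> real) \<Rightarrow> bool" where
  "gap_seq_le A L \<longleftrightarrow>
     (\<exists>N\<^sub>1. \<exists>f :: nat \<Rightarrow> nat. \<forall>n\<ge>N\<^sub>1. fst (A n) = fst (L (f n)))"

definition universal_gap_seq :: "real set \<Rightarrow> (nat \<Rightarrow> real \<times> real) \<Rightarrow> bool" where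
  "universal_gap_seq E L \<longleftrightarrow> L \<in> gap_seqs E \<and> (\<forall>B \<in> gap_seqs E. gap_seq_le B L)"

definition gap_limsup :: "(nat \<Rightarrow> real \<times> real) \<Rightarrow> ereal" where
  "gap_limsup L = limsup (\<lambda>n. ereal (fst (L n) / snd (L (Suc n))))"

end

theory Submission
  imports Defs
begin

text \<open>Both sides of the theorem are governed by one set of reals that depends only on the distance set
  \<open>E\<close>: the limit ratios, that is the cluster values of \<open>v / t\<close> for \<open>v, t \<in> E\<close> as \<open>t\<close> tends to zero.

  On the metric side, a normal scaling sequence is asymptotic to distances \<open>t n\<close> of points from \<open>p\<close>,
  so the distances from the marked point in the pretangent spaces are exactly the limit ratios; every
  limit ratio does occur, because a self-stable pair extends to a maximal self-stable family by Zorn's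
  lemma. As the diameter of a pointed space is between its radius and twice its radius, the family is
  uniformly bounded iff the limit ratios are bounded, and its radius is their supremum.

  On the side of \<open>E\<close>, suppose that the limit ratios are at most \<open>c\<close>, and let \<open>c' > c\<close>. By compactness no
  point of \<open>E\<close> lies in \<open>[c' * t, K * t]\<close> for \<open>t \<in> E\<close> small enough, whatever \<open>K\<close> is. So just above each
  small \<open>t\<close> there is a gap whose length is huge relative to \<open>t\<close>, which is strong porosity along every
  decreasing sequence. Conversely, if the limit ratios are unbounded, a single sequence that visits
  approximations of ever larger ones, each infinitely often, contradicts strong porosity along it.

  When the limit ratios are bounded, the long gaps near zero can be listed in decreasing order, and
  this list \<open>(l n, m n)\<close> is universal. Between consecutive gaps of the list \<open>E\<close> is confined to the blocks
  \<open>[m (n + 1), l n]\<close>. If \<open>t\<close> lies in such a block close to zero and \<open>v / t\<close> is bounded, then \<open>v \<le> l n\<close>,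
  so a limit ratio is at most \<open>limsup (l n / m (n + 1))\<close>. This upper limit cannot exceed the supremum
  of the limit ratios, as otherwise infinitely many blocks would contain a further long gap, contrary
  to universality.\<close>

section \<open>Ratios of elements near zero\<close>

text \<open>The cluster values of \<open>v / t\<close> for \<open>t, v \<in> E\<close> as \<open>t\<close> tends to zero from the right. They are
  the link between the two sides of the theorem: for a distance set they are exactly the distances
  from the marked point that occur in pretangent spaces with normal scaling.\<close>

definition limit_ratios :: "real set \<Rightarrow> real set" where
  "limit_ratios E =
     {s. \<forall>e>0. \<exists>t\<in>E. \<exists>v\<in>E. 0 < t \<and> t < e \<and> \<bar>v / t - s\<bar> < e}"

lemma limit_ratiosD:
  assumes "s \<in> limit_ratios E" and "0 < e" and "0 < h"
  shows "\<exists>t\<in>E. \<exists>v\<in>E. 0 < t \<and> t < e \<and> \<bar>v / t - s\<bar> < h"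
proof -
  have "0 < min e h" using assms by simp
  then obtain t v where "t \<in> E" "v \<in> E" "0 < t" "t < min e h" "\<bar>v / t - s\<bar> < min e h"
    using assms(1) unfolding limit_ratios_def by blast
  then show ?thesis by auto
qed

lemma limit_ratiosI_sequence:
  assumes E: "\<And>n. t n \<in> E" "\<And>n. v n \<in> E" and pos: "\<forall>\<^sub>F n in sequentially. 0 < t n"
    and t0: "t \<longlonglongrightarrow> 0" and lim: "(\<lambda>n. v n / t n) \<longlonglongrightarrow> s"
  shows "s \<in> limit_ratios E"
  unfolding limit_ratios_def
proof safe
  fix e :: real assume "0 < e"
  then have "\<forall>\<^sub>F n in sequentially. 0 < t n \<and> t n < e \<and> \<bar>v n / t n - s\<bar> < e"
    using pos order_tendstoD(2)[OF t0] tendstoD[OF lim]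
    by (auto simp: dist_real_def eventually_conj_iff)
  then obtain n where "0 < t n \<and> t n < e \<and> \<bar>v n / t n - s\<bar> < e"
    using eventually_happens'[OF sequentially_bot] by blast
  then show "\<exists>t\<in>E. \<exists>v\<in>E. 0 < t \<and> t < e \<and> \<bar>v / t - s\<bar> < e"
    using E by blast
qed

text \<open>Endpoints of gaps lie in the closure of \<open>E\<close> but perhaps not in \<open>E\<close>; this lemma allows ratios
  to be formed with them all the same.\<close>

lemma limit_ratios_closure: "limit_ratios (closure E) = limit_ratios E"
proof (intro equalityI subsetI)
  fix s assume "s \<in> limit_ratios E"
  then show "s \<in> limit_ratios (closure E)"
    unfolding limit_ratios_def using closure_subset by blast
next
  fix s assume s: "s \<in> limit_ratios (closure E)"
  show "s \<in> limit_ratios E"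
    unfolding limit_ratios_def
  proof safe
    fix e :: real assume "0 < e"
    then obtain t v where tv: "t \<in> closure E" "v \<in> closure E" "0 < t" "t < e" "\<bar>v / t - s\<bar> < e"
      using s unfolding limit_ratios_def by blast
    obtain x where x: "\<And>n. x n \<in> E" "x \<longlonglongrightarrow> t" using tv(1) by (auto simp: closure_sequential)
    obtain y where y: "\<And>n. y n \<in> E" "y \<longlonglongrightarrow> v" using tv(2) by (auto simp: closure_sequential)
    have "(\<lambda>n. \<bar>y n / x n - s\<bar>) \<longlonglongrightarrow> \<bar>v / t - s\<bar>"
      using x y tv(3) by (intro tendsto_intros) auto
    then have "\<forall>\<^sub>F n in sequentially. 0 < x n \<and> x n < e \<and> \<bar>y n / x n - s\<bar> < e"
      using order_tendstoD[OF x(2)] order_tendstoD(2) tv(3-5) by (auto simp: eventually_conj_iff)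
    then obtain n where "0 < x n \<and> x n < e \<and> \<bar>y n / x n - s\<bar> < e"
      using eventually_happens'[OF sequentially_bot] by blast
    then show "\<exists>t\<in>E. \<exists>v\<in>E. 0 < t \<and> t < e \<and> \<bar>v / t - s\<bar> < e"
      using x(1) y(1) by blast
  qed
qed

text \<open>The requirement \<open>Q k\<close> may change with the stage \<open>k\<close>: it can become stricter, run cyclically
  through several conditions, or force an index to grow.\<close>

lemma decreasing_null_choice:
  fixes f :: "'b \<Rightarrow> real"
  assumes ex: "\<And>(k::nat) e. 0 < e \<Longrightarrow> \<exists>x. 0 < f x \<and> f x < e \<and> Q k x"
  shows "\<exists>x. (\<forall>k. 0 < f (x k) \<and> Q k (x k) \<and> f (x (Suc k)) < f (x k)) \<and>
    (\<lambda>k. f (x k)) \<longlonglongrightarrow> 0"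
proof -
  let ?P = "\<lambda>k x. 0 < f x \<and> f x < inverse (real (Suc k)) \<and> Q k x"
  have "\<exists>x. \<forall>k. ?P k (x k) \<and> f (x (Suc k)) < f (x k)"
  proof (rule dependent_nat_choice)
    show "\<exists>x. ?P 0 x" by (rule ex) simp
    show "\<exists>y. ?P (Suc k) y \<and> f y < f x" if "?P k x" for x k
      using ex[of "min (f x) (inverse (real (Suc (Suc k))))" "Suc k"] that by auto
  qed
  then obtain x where x: "\<And>k. ?P k (x k)" "\<And>k. f (x (Suc k)) < f (x k)" by blast
  moreover have "(\<lambda>k. f (x k)) \<longlonglongrightarrow> 0"
    by (rule tendsto_sandwich[OF _ _ tendsto_const LIMSEQ_inverse_real_of_nat])
      (use x(1) in \<open>auto intro!: always_eventually less_imp_le\<close>)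
  ultimately show ?thesis by blast
qed

lemma almost_decreasingI: "(\<And>n. t (Suc n) \<le> t n) \<Longrightarrow> almost_decreasing t"
  by (simp add: almost_decreasing_def)

lemma limit_ratiosE_sequence:
  assumes "s \<in> limit_ratios E"
  obtains t v where "t \<in> decreasing_seqs E" "\<And>n. v n \<in> E" "(\<lambda>n. v n / t n) \<longlonglongrightarrow> s"
proof -
  have "\<exists>x. 0 < fst x \<and> fst x < e \<and>
      (fst x \<in> E \<and> snd x \<in> E \<and> \<bar>snd x / fst x - s\<bar> < inverse (real (Suc k)))"
    if "0 < e" for k :: nat and e
    using limit_ratiosD[OF assms that, of "inverse (real (Suc k))"] by force
  from decreasing_null_choice[where f = fst and
      Q = "\<lambda>k x. fst x \<in> E \<and> snd x \<in> E \<and> \<bar>snd x / fst x - s\<bar> < inverse (real (Suc k))", OF this]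
  obtain x where x: "\<And>k. 0 < fst (x k)"
      "\<And>k. fst (x k) \<in> E \<and> snd (x k) \<in> E \<and> \<bar>snd (x k) / fst (x k) - s\<bar> < inverse (real (Suc k))"
      "\<And>k. fst (x (Suc k)) < fst (x k)" "(\<lambda>k. fst (x k)) \<longlonglongrightarrow> 0"
    by blast
  show thesis
  proof (rule that)
    show "(\<lambda>k. fst (x k)) \<in> decreasing_seqs E"
      using x less_imp_neq[OF x(1)]
      by (auto simp: decreasing_seqs_def intro!: almost_decreasingI less_imp_le)
    show "(\<lambda>k. snd (x k) / fst (x k)) \<longlonglongrightarrow> s"
      by (rule metric_tendsto_imp_tendsto[OF LIMSEQ_inverse_real_of_nat])
        (use x(2) in \<open>auto simp: dist_real_def intro!: always_eventually less_imp_le\<close>)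
  qed (use x(2) in auto)
qed

text \<open>Any window of ratios \<open>[c', K]\<close> above the limit ratios is eventually avoided: offending pairs
  \<open>t, v\<close> with \<open>t\<close> arbitrarily small would have ratios that cluster, by compactness of the window, at
  a limit ratio inside it.\<close>

lemma eventually_avoids_window:
  assumes c: "\<And>s. s \<in> limit_ratios E \<Longrightarrow> s \<le> c" and "c < c'"
  obtains \<delta> where "0 < \<delta>"
    "\<And>t v. \<lbrakk>t \<in> closure E; v \<in> closure E; 0 < t; t < \<delta>; c' * t \<le> v\<rbrakk> \<Longrightarrow> K * t < v"
proof (rule ccontr)
  assume neg: "\<not> thesis"
  note witness = that
  have "\<exists>x. 0 < fst x \<and> fst x < e \<and>
      (fst x \<in> closure E \<and> snd x \<in> closure E \<and> snd x / fst x \<in> {c'..K})" if "0 < e" for e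
  proof (rule ccontr)
    assume none: "\<nexists>x. 0 < fst x \<and> fst x < e \<and>
      (fst x \<in> closure E \<and> snd x \<in> closure E \<and> snd x / fst x \<in> {c'..K})"
    have "K * t < v" if "t \<in> closure E" "v \<in> closure E" "0 < t" "t < e" "c' * t \<le> v" for t v
    proof (rule ccontr)
      assume "\<not> K * t < v"
      then have "v / t \<in> {c'..K}" using that by (simp add: field_simps)
      then show False using none that by (metis fst_conv snd_conv)
    qed
    then show False using neg witness[of e] \<open>0 < e\<close> by blast
  qed
  from decreasing_null_choice[where f = fst and
      Q = "\<lambda>k x. fst x \<in> closure E \<and> snd x \<in> closure E \<and> snd x / fst x \<in> {c'..K}", OF this]
  obtain x :: "nat \<Rightarrow> real \<times> real" where x: "\<And>k. 0 < fst (x k)"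
      "\<And>k. fst (x k) \<in> closure E \<and> snd (x k) \<in> closure E \<and> snd (x k) / fst (x k) \<in> {c'..K}"
      "(\<lambda>k. fst (x k)) \<longlonglongrightarrow> 0"
    by blast
  obtain s r where s: "s \<in> {c'..K}" "strict_mono r"
      "((\<lambda>k. snd (x k) / fst (x k)) \<circ> r) \<longlonglongrightarrow> s"
    by (rule seq_compactE[OF compact_imp_seq_compact[OF compact_Icc[of c' K]],
          of "\<lambda>k. snd (x k) / fst (x k)"]) (use x(2) in blast)+
  have "s \<in> limit_ratios (closure E)"
  proof (rule limit_ratiosI_sequence)
    show "(\<lambda>k. fst (x (r k))) \<longlonglongrightarrow> 0"
      using LIMSEQ_subseq_LIMSEQ[OF x(3) s(2)] by (simp add: o_def)
    show "(\<lambda>k. snd (x (r k)) / fst (x (r k))) \<longlonglongrightarrow> s" using s(3) by (simp add: o_def)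
  qed (use x in auto)
  then show False using c[of s] s(1) \<open>c < c'\<close> by (simp add: limit_ratios_closure)
qed

section \<open>Gaps\<close>

abbreviation is_gap :: "real set \<Rightarrow> real \<Rightarrow> real \<Rightarrow> bool" where
  "is_gap E a b \<equiv> {a<..<b} \<in> components (interior ({0..} - E))"

lemma is_gapI:
  assumes "0 \<le> a" "a < b" and cl: "a \<in> closure E" "b \<in> closure E" and dis: "{a<..<b} \<inter> E = {}"
  shows "is_gap E a b"
  unfolding gap_component_iff
proof (intro conjI allI impI)
  fix a' b' assume *: "0 \<le> a' \<and> {a<..<b} \<subset> {a'<..<b'}"
  then have "a' \<le> a" "b \<le> b'" "a' < a \<or> b < b'"
    using \<open>a < b\<close> by (auto simp: greaterThanLessThan_subseteq_greaterThanLessThan)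
  then have "a \<in> {a'<..<b'} \<or> b \<in> {a'<..<b'}" using \<open>a < b\<close> by auto
  then have "{a'<..<b'} \<inter> closure E \<noteq> {}" using cl by blast
  then show "{a'<..<b'} \<inter> E \<noteq> {}"
    using open_Int_closure_eq_empty[OF open_greaterThanLessThan] by blast
qed (use assms in auto)

lemma is_gapD:
  assumes "is_gap E a b"
  shows "0 \<le> a" "a < b" "{a<..<b} \<inter> closure E = {}"
  using assms open_Int_closure_eq_empty[OF open_greaterThanLessThan, of a b E]
  unfolding gap_component_iff by auto

lemma gap_seqs_iff:
  "A \<in> gap_seqs E \<longleftrightarrow>
     (\<forall>n. is_gap E (fst (A n)) (snd (A n))) \<and> almost_decreasing (\<lambda>n. fst (A n)) \<and>
     (\<lambda>n. fst (A n)) \<longlonglongrightarrow> 0 \<and> (\<lambda>n. fst (A n) / snd (A n)) \<longlonglongrightarrow> 0"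
proof -
  have "((\<lambda>n. (snd (A n) - fst (A n)) / snd (A n)) \<longlonglongrightarrow> 1) \<longleftrightarrow>
      ((\<lambda>n. fst (A n) / snd (A n)) \<longlonglongrightarrow> 0)"
    if "\<forall>n. is_gap E (fst (A n)) (snd (A n))"
  proof -
    have "0 < snd (A n)" for n using that is_gapD by (meson le_less_trans)
    then have nz: "snd (A n) \<noteq> 0" for n by (simp add: less_imp_neq[symmetric])
    have eq: "(snd (A n) - fst (A n)) / snd (A n) = 1 - fst (A n) / snd (A n)" for n
      using nz by (simp add: diff_divide_distrib)
    let ?q = "\<lambda>n. fst (A n) / snd (A n)"
    have "(\<lambda>n. 1 - ?q n) \<longlonglongrightarrow> 1 \<Longrightarrow> ?q \<longlonglongrightarrow> 0"
      using tendsto_diff[OF tendsto_const, of "\<lambda>n. 1 - ?q n" 1 sequentially 1] by simp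
    moreover have "?q \<longlonglongrightarrow> 0 \<Longrightarrow> (\<lambda>n. 1 - ?q n) \<longlonglongrightarrow> 1"
      using tendsto_diff[OF tendsto_const, of ?q 0 sequentially 1] by simp
    ultimately have "((\<lambda>n. 1 - ?q n) \<longlonglongrightarrow> 1) \<longleftrightarrow> (?q \<longlonglongrightarrow> 0)" by blast
    then show ?thesis by (simp add: eq)
  qed
  then show ?thesis unfolding gap_seqs_def by auto
qed

locale nonneg_set_with_zero =
  fixes E :: "real set"
  assumes nonneg: "E \<subseteq> {0..}" and zero: "0 \<in> E"
begin

lemma closure_nonneg: "x \<in> closure E \<Longrightarrow> 0 \<le> x"
  using closure_minimal[OF nonneg closed_atLeast] by auto

lemma gap_endpoints_in_closure:
  assumes gap: "is_gap E a b"
  shows "a \<in> closure E" "b \<in> closure E"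
proof -
  have near: "\<exists>e>0. \<forall>y\<in>E. e \<le> \<bar>y - x\<bar>" if "x \<notin> closure E" for x
    using that unfolding closure_approachable by (auto simp: dist_real_def not_less)
  have meets: "{a'<..<b'} \<inter> E \<noteq> {}" if "0 \<le> a'" "{a<..<b} \<subset> {a'<..<b'}" for a' b'
    using gap that unfolding gap_component_iff by blast
  have ab: "0 \<le> a" "a < b" and dis: "\<And>y. y \<in> E \<Longrightarrow> \<not> (a < y \<and> y < b)"
    using gap unfolding gap_component_iff by auto
  show "a \<in> closure E"
  proof (rule ccontr)
    assume "a \<notin> closure E"
    then obtain e where e: "e > 0" "\<And>y. y \<in> E \<Longrightarrow> e \<le> \<bar>y - a\<bar>" using near by blast
    have "0 < a" using e(2)[OF zero] ab e(1) by auto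
    then have "a \<in> {max 0 (a - e)<..<b} - {a<..<b}" using e(1) ab by auto
    then have "{a<..<b} \<subset> {max 0 (a - e)<..<b}" by auto
    then obtain y where "y \<in> E" "a - e < y" "y < b" using meets[of "max 0 (a - e)" b] by auto
    then show False using e(2)[of y] dis[of y] by auto
  qed
  show "b \<in> closure E"
  proof (rule ccontr)
    assume "b \<notin> closure E"
    then obtain e where e: "e > 0" "\<And>y. y \<in> E \<Longrightarrow> e \<le> \<bar>y - b\<bar>" using near by blast
    have "b \<in> {a<..<b + e} - {a<..<b}" using e(1) ab by auto
    then have "{a<..<b} \<subset> {a<..<b + e}" using e(1) by auto
    then obtain y where "y \<in> E" "a < y" "y < b + e" using meets[of a "b + e"] ab by auto
    then show False using e(2)[of y] dis[of y] by auto
  qed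
qed

lemma gap_left_of_gap:
  assumes "is_gap E a b" "is_gap E a' b'" "a' < a"
  shows "b' \<le> a"
proof (rule ccontr)
  assume "\<not> b' \<le> a"
  then have "a \<in> {a'<..<b'} \<inter> closure E"
    using gap_endpoints_in_closure(1)[OF assms(1)] assms(3) by simp
  then show False using is_gapD(3)[OF assms(2)] by blast
qed

lemma gap_left_end_pos:
  assumes "0 islimpt E" "is_gap E a b"
  shows "0 < a"
proof (rule ccontr)
  assume "\<not> 0 < a"
  then have "a = 0" "0 < b" using is_gapD[OF assms(2)] by auto
  then obtain y where "y \<in> E" "y \<noteq> 0" "dist y 0 < b"
    using assms(1) unfolding islimpt_approachable by blast
  then have "y \<in> {a<..<b} \<inter> E" using nonneg \<open>a = 0\<close> by auto
  then show False using is_gapD(3)[OF assms(2)] closure_subset by blast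
qed

lemma islimpt_if_decreasing_seq:
  assumes "t \<in> decreasing_seqs E"
  shows "0 islimpt E"
  using assms unfolding decreasing_seqs_def islimpt_sequential by blast

lemma limit_ratios_islimpt:
  assumes "s \<in> limit_ratios E"
  shows "0 islimpt E"
  using limit_ratiosE_sequence[OF assms] islimpt_if_decreasing_seq by metis

lemma decreasing_seqsD:
  assumes "t \<in> decreasing_seqs E"
  shows "t n \<in> closure E" "0 < t n" "almost_decreasing t" "t \<longlonglongrightarrow> 0"
proof -
  have "t n \<in> E" "t n \<noteq> 0" using assms by (auto simp: decreasing_seqs_def)
  then show "t n \<in> closure E" "0 < t n" using nonneg closure_subset[of E] by fastforce+
qed (use assms in \<open>auto simp: decreasing_seqs_def\<close>)

lemma one_in_limit_ratios:
  assumes "0 islimpt E"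
  shows "1 \<in> limit_ratios E"
  unfolding limit_ratios_def
proof safe
  fix e :: real assume "0 < e"
  then obtain y where "y \<in> E" "y \<noteq> 0" "dist y 0 < e"
    using assms unfolding islimpt_approachable by blast
  then show "\<exists>t\<in>E. \<exists>v\<in>E. 0 < t \<and> t < e \<and> \<bar>v / t - 1\<bar> < e"
    using nonneg \<open>0 < e\<close> by (intro bexI[of _ y]) auto
qed

section \<open>Complete strong porosity as boundedness of the limit ratios\<close>

text \<open>If the limit ratios are at most \<open>c\<close>, then close to zero the points of \<open>closure E\<close> above \<open>t\<close>
  are either below \<open>c' * t\<close> or far beyond it. So the gap around \<open>c' * t\<close> has its left end within a
  factor \<open>c'\<close> of \<open>t\<close>, and its relative length tends to one.\<close>

lemma gap_seq_above_sequence: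
  assumes c: "\<And>s. s \<in> limit_ratios E \<Longrightarrow> s \<le> c" "c < c'" "1 \<le> c'"
    and t: "\<And>n. t n \<in> closure E" "\<And>n. 0 < t n" "almost_decreasing t" "t \<longlonglongrightarrow> 0"
  obtains A where "A \<in> gap_seqs E" "\<forall>\<^sub>F n in sequentially. t n \<le> fst (A n) \<and> fst (A n) \<le> c' * t n"
proof -
  let ?F = "closure E"
  define up where "up x = Sup (?F \<inter> {..c' * x})" for x
  define dn where "dn x = Inf (?F \<inter> {c' * x..})" for x
  obtain \<delta> where \<delta>: "0 < \<delta>"
    "\<And>t v. \<lbrakk>t \<in> ?F; v \<in> ?F; 0 < t; t < \<delta>; c' * t \<le> v\<rbrakk> \<Longrightarrow> c' * t < v"
    using eventually_avoids_window[OF c(1,2), of E c'] by blast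
  have bdd: "bdd_above (?F \<inter> {..c' * x})" "bdd_below (?F \<inter> {c' * x..})" for x
    by (auto intro: bdd_aboveI bdd_belowI)
  have up: "up x \<in> ?F" "x \<le> up x" "up x \<le> c' * x" if "x \<in> ?F" "0 < x" for x
  proof -
    have "x \<in> ?F \<inter> {..c' * x}" using that c(3) mult_right_mono[of 1 c' x] by auto
    then show "x \<le> up x" unfolding up_def by (intro cSup_upper bdd)
    have "up x \<in> ?F \<inter> {..c' * x}"
      unfolding up_def
      using \<open>x \<in> ?F \<inter> {..c' * x}\<close> by (intro closed_contains_Sup bdd closed_Int) auto
    then show "up x \<in> ?F" "up x \<le> c' * x" by auto
  qed
  have dn: "dn x \<in> ?F" "c' * x \<le> dn x" if "c' * x \<le> t 0" for x
  proof -
    have "dn x \<in> ?F \<inter> {c' * x..}"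
      unfolding dn_def using that t(1) by (intro closed_contains_Inf bdd closed_Int) auto
    then show "dn x \<in> ?F" "c' * x \<le> dn x" by auto
  qed
  have gap: "is_gap E (up x) (dn x)" if x: "x \<in> ?F" "0 < x" "x < \<delta>" "c' * x \<le> t 0" for x
  proof (rule is_gapI)
    have "c' * x < dn x" using \<delta>(2)[OF x(1) dn(1)[OF x(4)] x(2,3) dn(2)[OF x(4)]] .
    then show "up x < dn x" using up(3)[OF x(1,2)] by simp
    show "{up x<..<dn x} \<inter> E = {}"
    proof (rule ccontr)
      assume "{up x<..<dn x} \<inter> E \<noteq> {}"
      then obtain y where y: "y \<in> ?F" "up x < y" "y < dn x" using closure_subset by fastforce
      show False
      proof (cases "y \<le> c' * x")
        case True
        then have "y \<le> up x" unfolding up_def using y(1) by (intro cSup_upper bdd) auto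
        then show False using y(2) by simp
      next
        case False
        then have "dn x \<le> y" unfolding dn_def using y(1) by (intro cInf_lower bdd) auto
        then show False using y(3) by simp
      qed
    qed
    show "0 \<le> up x" using closure_nonneg up(1)[OF x(1,2)] .
  qed (use up(1) dn(1) x in auto)
  have up_mono: "up x \<le> up y" if "x \<le> y" "x \<in> ?F" "0 < x" for x y
  proof -
    have "c' * x \<le> c' * y" using that c(3) by (intro mult_left_mono) auto
    moreover have "x \<le> c' * x" using that c(3) mult_right_mono[of 1 c' x] by auto
    ultimately show ?thesis
      unfolding up_def using that(2) by (intro cSup_subset_mono bdd) auto
  qed
  have small: "\<forall>\<^sub>F n in sequentially. t n < e" if "0 < e" for e
    using order_tendstoD(2)[OF t(4) that] .
  have "\<forall>\<^sub>F n in sequentially. t n < \<delta> \<and> t n < t 0 / c' \<and> t (Suc n) \<le> t n"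
    using small[OF \<delta>(1)] small[of "t 0 / c'"] t(2)[of 0] t(3) c(3)
    by (auto simp: almost_decreasing_def eventually_conj_iff)
  then obtain N where N: "\<And>n. N \<le> n \<Longrightarrow> t n < \<delta> \<and> t n < t 0 / c' \<and> t (Suc n) \<le> t n"
    unfolding eventually_sequentially by blast
  \<comment> \<open>The construction works from some index \<open>N\<close> on; earlier entries repeat the one at \<open>N\<close>.\<close>
  define u where "u n = t (max n N)" for n
  define A where "A n = (up (u n), dn (u n))" for n
  have u: "u n \<in> ?F" "0 < u n" "u n < \<delta>" "c' * u n \<le> t 0" for n
    using t(1,2) N[of "max n N"] c(3) by (auto simp: u_def field_simps)
  have eq: "\<forall>\<^sub>F n in sequentially. u n = t n"
    unfolding u_def using eventually_ge_at_top[of N] by eventually_elim simp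
  have u0: "u \<longlonglongrightarrow> 0" using t(4) tendsto_cong[OF eq] by simp
  have udec: "u (Suc n) \<le> u n" for n
    using N[of n] by (cases "N \<le> n") (auto simp: u_def max_def not_less_eq_eq)
  have up0: "(\<lambda>n. up (u n)) \<longlonglongrightarrow> 0"
  proof (rule tendsto_sandwich[OF _ _ tendsto_const])
    show "\<forall>\<^sub>F n in sequentially. 0 \<le> up (u n)" using closure_nonneg up(1) u by simp
    show "\<forall>\<^sub>F n in sequentially. up (u n) \<le> c' * u n" using up(3) u by simp
    show "(\<lambda>n. c' * u n) \<longlonglongrightarrow> 0" using tendsto_mult[OF tendsto_const u0, of c'] by simp
  qed
  have ratio: "(\<lambda>n. up (u n) / dn (u n)) \<longlonglongrightarrow> 0"
  proof (rule tendstoI)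
    fix e :: real assume e: "0 < e"
    obtain \<eta> where \<eta>: "0 < \<eta>"
      "\<And>t v. \<lbrakk>t \<in> ?F; v \<in> ?F; 0 < t; t < \<eta>; c' * t \<le> v\<rbrakk> \<Longrightarrow> c' / e * t < v"
      using eventually_avoids_window[OF c(1,2), of E "c' / e"] by blast
    have "\<forall>\<^sub>F n in sequentially. u n < \<eta>" using order_tendstoD(2)[OF u0 \<eta>(1)] .
    then show "\<forall>\<^sub>F n in sequentially. dist (up (u n) / dn (u n)) 0 < e"
    proof eventually_elim
      case (elim n)
      have far: "c' / e * u n < dn (u n)"
        using \<eta>(2)[OF u(1) dn(1)[OF u(4)] u(2) elim dn(2)[OF u(4)]] .
      have "0 < up (u n)" "up (u n) \<le> c' * u n" using up[OF u(1,2), of n] u(2)[of n] by auto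
      moreover have "c' * u n < e * dn (u n)" using far e by (simp add: field_simps)
      moreover have "0 < dn (u n)"
        using is_gapD[OF gap[OF u]] by (meson le_less_trans)
      ultimately show ?case by (simp add: divide_simps)
    qed
  qed
  show thesis
  proof (rule that[of A])
    show "A \<in> gap_seqs E"
      using gap u up0 ratio up_mono[OF udec u(1,2)]
      by (auto simp: gap_seqs_iff A_def intro: almost_decreasingI)
    show "\<forall>\<^sub>F n in sequentially. t n \<le> fst (A n) \<and> fst (A n) \<le> c' * t n"
      using eq
    proof eventually_elim
      case (elim n)
      then show ?case using up(2,3)[OF u(1,2), of n] by (simp add: A_def)
    qed
  qed
qed

text \<open>Since all terms are positive, finitely many of them only affect the constants.\<close>

lemma seq_asympI_eventually:
  assumes pos: "\<And>n. 0 < t n" "\<And>n. 0 < a n"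
    and ev: "\<forall>\<^sub>F n in sequentially. t n \<le> a n \<and> a n \<le> c * t n"
  shows "seq_asymp t a"
proof -
  obtain N where N: "\<And>n. N \<le> n \<Longrightarrow> t n \<le> a n \<and> a n \<le> c * t n"
    using ev unfolding eventually_sequentially by blast
  define lo where "lo = Min (insert 1 ((\<lambda>n. a n / t n) ` {..<N}))"
  define hi where "hi = Max (insert c ((\<lambda>n. a n / t n) ` {..<N}))"
  have "0 < lo" unfolding lo_def using pos by (subst Min_gr_iff) auto
  have bounds: "lo \<le> a n / t n \<and> a n / t n \<le> hi" for n
  proof (cases "n < N")
    case True
    then show ?thesis unfolding lo_def hi_def by (intro conjI Min_le Max_ge) auto
  next
    case False
    then have "1 \<le> a n / t n" "a n / t n \<le> c" using N[of n] pos by (auto simp: divide_simps)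
    moreover have "lo \<le> 1" "c \<le> hi" unfolding lo_def hi_def by (auto intro: Min_le Max_ge)
    ultimately show ?thesis by linarith
  qed
  have "0 < hi" using bounds[of 0] \<open>0 < lo\<close> by linarith
  have "lo / 2 * t n < a n \<and> a n < 2 * hi * t n" for n
  proof -
    have "lo / 2 * t n < lo * t n" "hi * t n < 2 * hi * t n"
      using \<open>0 < lo\<close> \<open>0 < hi\<close> pos by auto
    moreover have "lo * t n \<le> a n" "a n \<le> hi * t n"
      using bounds[of n] pos[of n] by (auto simp: field_simps)
    ultimately show ?thesis by linarith
  qed
  then show ?thesis
    unfolding seq_asymp_def using \<open>0 < lo\<close> \<open>0 < hi\<close>
    by (intro exI[of _ "lo / 2"] exI[of _ "2 * hi"]) auto
qed

text \<open>Porosity along each single sequence comes with a constant that depends on the sequence. It is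
  made uniform by interleaving: if there were limit ratios \<open>s j > j\<close> for all \<open>j\<close>, one decreasing
  sequence could contain, for every \<open>j\<close>, infinitely many \<open>t\<close> with some \<open>v / t\<close> near \<open>s j\<close>, and the
  constant of that sequence would bound every \<open>s j\<close>.\<close>

theorem completely_strongly_porous_iff_limit_ratios_bounded:
  "completely_strongly_porous E \<longleftrightarrow> (\<exists>c. \<forall>s\<in>limit_ratios E. s \<le> c)"
proof
  assume "\<exists>c. \<forall>s\<in>limit_ratios E. s \<le> c"
  then obtain c where c: "\<And>s. s \<in> limit_ratios E \<Longrightarrow> s \<le> c" by blast
  show "completely_strongly_porous E"
    unfolding completely_strongly_porous_def strongly_porous_along_def
  proof
    fix t assume t: "t \<in> decreasing_seqs E"
    note t' = decreasing_seqsD[OF t]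
    have c': "c < max 1 (c + 1)" "1 \<le> max 1 (c + 1)" by auto
    obtain A where A: "A \<in> gap_seqs E"
        "\<forall>\<^sub>F n in sequentially. t n \<le> fst (A n) \<and> fst (A n) \<le> max 1 (c + 1) * t n"
      using gap_seq_above_sequence[where t = t, OF c c' t'] by blast
    have "0 < fst (A n)" for n
      using A(1) gap_left_end_pos[OF islimpt_if_decreasing_seq[OF t]] by (auto simp: gap_seqs_iff)
    then have "seq_asymp t (\<lambda>n. fst (A n))"
      by (rule seq_asympI_eventually[where t = t, OF t'(2) _ A(2)])
    with A(1) show "\<exists>A\<in>gap_seqs E. seq_asymp t (\<lambda>n. fst (A n))" by blast
  qed
next
  assume csp: "completely_strongly_porous E"
  show "\<exists>c. \<forall>s\<in>limit_ratios E. s \<le> c"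
  proof (rule ccontr)
    assume "\<nexists>c. \<forall>s\<in>limit_ratios E. s \<le> c"
    then have "\<forall>j::nat. \<exists>s\<in>limit_ratios E. real j < s" by (metis not_le)
    then obtain s where s: "\<And>j. s j \<in> limit_ratios E" "\<And>j. real j < s j" by metis
    \<comment> \<open>The index \<open>j k\<close> takes every value infinitely often.\<close>
    define j where "j k = fst (prod_decode k)" for k
    have "\<exists>x. 0 < fst x \<and> fst x < e \<and>
        (fst x \<in> E \<and> snd x \<in> E \<and> \<bar>snd x / fst x - s (j k)\<bar> < 1)" if "0 < e" for k e
      using limit_ratiosD[OF s(1) that, of 1 "j k"] by force
    from decreasing_null_choice[where f = fst and
        Q = "\<lambda>k x. fst x \<in> E \<and> snd x \<in> E \<and> \<bar>snd x / fst x - s (j k)\<bar> < 1", OF this]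
    obtain x where x: "\<And>k. 0 < fst (x k)"
        "\<And>k. fst (x k) \<in> E \<and> snd (x k) \<in> E \<and> \<bar>snd (x k) / fst (x k) - s (j k)\<bar> < 1"
        "\<And>k. fst (x (Suc k)) < fst (x k)" "(\<lambda>k. fst (x k)) \<longlonglongrightarrow> 0"
      by blast
    define t v where "t = (\<lambda>k. fst (x k))" and "v = (\<lambda>k. snd (x k))"
    have "t \<in> decreasing_seqs E"
      using x less_imp_neq[OF x(1)]
      by (auto simp: decreasing_seqs_def t_def intro!: almost_decreasingI less_imp_le)
    then obtain A c1 c2 where A: "A \<in> gap_seqs E" and c12: "0 < c1" "0 < c2"
        "\<And>k. c1 * t k < fst (A k)" "\<And>k. fst (A k) < c2 * t k"
      using csp unfolding completely_strongly_porous_def strongly_porous_along_def seq_asymp_def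
      by blast
    obtain i :: nat where i: "c2 + 1 \<le> real i" using real_arch_simple by blast
    have "0 < c1 / (s i + 1)" using c12 s(2)[of i] by auto
    moreover have "(\<lambda>k. fst (A k) / snd (A k)) \<longlonglongrightarrow> 0" using A by (simp add: gap_seqs_iff)
    ultimately have "\<forall>\<^sub>F k in sequentially. fst (A k) / snd (A k) < c1 / (s i + 1)"
      by (rule order_tendstoD(2)[rotated])
    then obtain N where N: "\<And>k. N \<le> k \<Longrightarrow> fst (A k) / snd (A k) < c1 / (s i + 1)"
      unfolding eventually_sequentially by blast
    \<comment> \<open>An index beyond \<open>N\<close> whose pair approximates \<open>s i\<close>.\<close>
    define k where "k = prod_encode (i, N)"
    have k: "N \<le> k" "j k = i" by (simp_all add: k_def j_def le_prod_encode_2)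
    have gap: "is_gap E (fst (A k)) (snd (A k))" using A by (simp add: gap_seqs_iff)
    have tk: "0 < t k" and vk: "v k \<in> E" "\<bar>v k / t k - s i\<bar> < 1"
      using x(1,2)[of k] k(2) by (auto simp: t_def v_def)
    have "c2 < v k / t k" using vk(2) i s(2)[of i] by linarith
    then have "fst (A k) < v k" using tk c12(4)[of k] by (simp add: field_simps)
    then have "snd (A k) \<le> v k"
      using is_gapD(3)[OF gap] vk(1) closure_subset[of E] by force
    also have "v k < (s i + 1) * t k" using vk(2) tk by (simp add: abs_less_iff field_simps)
    finally have "c1 * snd (A k) < (s i + 1) * (c1 * t k)" using c12(1) by simp
    also have "\<dots> < (s i + 1) * fst (A k)" using c12(3)[of k] s(2)[of i] by simp
    finally have "c1 / (s i + 1) < fst (A k) / snd (A k)"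
      using is_gapD[OF gap] s(2)[of i] by (simp add: field_simps)
    then show False using N[OF k(1)] by simp
  qed
qed

end

section \<open>Universal gap sequences\<close>

lemma almost_decreasingE:
  assumes "almost_decreasing t"
  obtains N where "\<And>i j. \<lbrakk>N \<le> i; i \<le> j\<rbrakk> \<Longrightarrow> t j \<le> t i"
proof -
  obtain N where N: "\<And>n. N \<le> n \<Longrightarrow> t (Suc n) \<le> t n"
    using assms unfolding almost_decreasing_def eventually_sequentially by blast
  have "t j \<le> t i" if "N \<le> i" "i \<le> j" for i j
    using that(2,1)
  proof (induction rule: dec_induct)
    case (step n)
    then show ?case using N[of n] by simp
  qed simp
  then show thesis using that by blast
qed

context nonneg_set_with_zero
begin

text \<open>For \<open>Q\<close> above all limit ratios, the gaps \<open>(a, b)\<close> with \<open>b \<ge> Q * a\<close> have ratios \<open>b / a\<close>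
  tending to infinity as \<open>a\<close> tends to zero, since these ratios have no cluster value in \<open>[Q, \<infinity>)\<close>.
  Their left ends decrease at least geometrically, so they can be listed in decreasing order without
  omission, and the entries of any gap sequence are eventually among them.\<close>

lemma universal_gap_seq_exists:
  assumes c: "\<And>s. s \<in> limit_ratios E \<Longrightarrow> s \<le> c" and lim: "0 islimpt E"
  shows "\<exists>L. universal_gap_seq E L"
proof -
  define Q where "Q = max 2 (c + 1)"
  have Q: "2 \<le> Q" "c < Q" by (auto simp: Q_def)
  define G where "G = {a. \<exists>b. is_gap E a b \<and> Q * a \<le> b}"
  have Gpos: "0 < a" if "a \<in> G" for a
    using that gap_left_end_pos[OF lim] by (auto simp: G_def)
  have Gsep: "Q * a' \<le> a" if "a \<in> G" "a' \<in> G" "a' < a" for a a'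
    using that gap_left_of_gap unfolding G_def by (blast intro: order_trans)
  have inG: "\<forall>\<^sub>F n in sequentially. fst (B n) \<in> G \<and> fst (B n) < e"
    if B: "B \<in> gap_seqs E" and e: "0 < e" for B e
  proof -
    have B': "\<And>n. is_gap E (fst (B n)) (snd (B n))" "(\<lambda>n. fst (B n)) \<longlonglongrightarrow> 0"
        "(\<lambda>n. fst (B n) / snd (B n)) \<longlonglongrightarrow> 0"
      using B by (auto simp: gap_seqs_iff)
    have "\<forall>\<^sub>F n in sequentially. fst (B n) / snd (B n) < 1 / Q"
      using order_tendstoD(2)[OF B'(3)] Q by simp
    then show ?thesis
      using order_tendstoD(2)[OF B'(2) e]
    proof eventually_elim
      case (elim n)
      have "0 < snd (B n)" using is_gapD[OF B'(1)[of n]] by linarith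
      then have "Q * fst (B n) \<le> snd (B n)" using elim(1) Q by (simp add: field_simps)
      then show ?case using B'(1) elim(2) by (auto simp: G_def)
    qed
  qed
  have Gsmall: "\<exists>a\<in>G. a < e" if e: "0 < e" for e
  proof -
    obtain t v where t: "t \<in> decreasing_seqs E"
      by (rule limit_ratiosE_sequence[OF one_in_limit_ratios[OF lim]])
    have "1 \<le> Q" using Q by simp
    obtain A where "A \<in> gap_seqs E"
      using gap_seq_above_sequence[where t = t, OF c Q(2) \<open>1 \<le> Q\<close> decreasing_seqsD[OF t]] by blast
    from inG[OF this e] show ?thesis
      using eventually_happens'[OF sequentially_bot] by blast
  qed
  have next_left_end: "\<exists>a'. a' \<in> G \<and> a' < a \<and> (\<forall>g\<in>G. g < a \<longrightarrow> g \<le> a')" if a: "a \<in> G" for a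
  proof -
    let ?S = "{g \<in> G. g < a}"
    have ne: "?S \<noteq> {}" and bdd: "bdd_above ?S"
      using Gsmall[OF Gpos[OF a]] by (auto intro!: bdd_aboveI[of _ a])
    have upper: "g \<le> Sup ?S" if "g \<in> ?S" for g using cSup_upper[OF that bdd] .
    have "0 < Sup ?S" using ne upper Gpos by (metis (lifting) ex_in_conv mem_Collect_eq less_le_trans)
    \<comment> \<open>An element within a factor \<open>Q\<close> of the supremum is the maximum.\<close>
    then have "Sup ?S / Q < Sup ?S" using Q by (simp add: field_simps)
    then obtain a' where a': "a' \<in> ?S" "Sup ?S / Q < a'" using less_cSupE[OF _ ne] by blast
    have "g \<le> a'" if g: "g \<in> G" "g < a" for g
    proof (rule ccontr)
      assume "\<not> g \<le> a'"
      then have "Q * a' \<le> g" using Gsep[OF g(1)] a'(1) by simp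
      also have "g \<le> Sup ?S" using upper g by simp
      finally show False using a'(2) Q by (simp add: field_simps)
    qed
    then show ?thesis using a'(1) by blast
  qed
  have "\<exists>l. \<forall>n. l n \<in> G \<and> (l (Suc n) < l n \<and> (\<forall>g\<in>G. g < l n \<longrightarrow> g \<le> l (Suc n)))"
  proof (rule dependent_nat_choice)
    show "\<exists>a. a \<in> G" using Gsmall[of 1] by auto
  qed (use next_left_end in blast)
  then obtain l where l: "\<And>n::nat. l n \<in> G" "\<And>n. l (Suc n) < l n"
      "\<And>n g. \<lbrakk>g \<in> G; g < l n\<rbrakk> \<Longrightarrow> g \<le> l (Suc n)"
    by blast
  have geometric: "l n \<le> l 0 * (1 / 2) ^ n" for n
  proof (induction n)
    case (Suc n)
    have "2 * l (Suc n) \<le> Q * l (Suc n)" using Q Gpos[OF l(1)[of "Suc n"]] by simp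
    then show ?case using Gsep[OF l(1) l(1) l(2)[of n]] Suc by simp
  qed simp
  have "(\<lambda>n. l 0 * (1 / 2) ^ n) \<longlonglongrightarrow> l 0 * 0"
    by (intro tendsto_mult tendsto_const LIMSEQ_power_zero) simp
  then have "(\<lambda>n. l 0 * (1 / 2) ^ n) \<longlonglongrightarrow> 0" by simp
  then have l0: "l \<longlonglongrightarrow> 0"
    by (rule tendsto_sandwich[OF _ _ tendsto_const, rotated 2])
      (use geometric less_imp_le[OF Gpos[OF l(1)]] in \<open>auto intro!: always_eventually\<close>)
  have covers: "\<exists>n. a = l n" if a: "a \<in> G" "a \<le> l 0" for a
  proof -
    have "\<exists>n. l n < a"
      using order_tendstoD(2)[OF l0 Gpos[OF a(1)]] eventually_happens'[OF sequentially_bot] by blast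
    then obtain n where n: "l n < a" "\<And>i. i < n \<Longrightarrow> \<not> l i < a"
      using exists_least_iff[of "\<lambda>n. l n < a"] by blast
    then obtain i where i: "n = Suc i" using a(2) by (cases n) auto
    have "\<not> a < l i" using l(3)[OF a(1), of i] n(1) i by auto
    then show ?thesis using n(2)[of i] i by (intro exI[of _ i]) auto
  qed
  have "\<forall>n. \<exists>b. is_gap E (l n) b \<and> Q * l n \<le> b" using l(1) by (auto simp: G_def)
  then obtain m where m: "\<And>n. is_gap E (l n) (m n)" "\<And>n. Q * l n \<le> m n" by metis
  define L where "L n = (l n, m n)" for n
  have ratio: "(\<lambda>n. l n / m n) \<longlonglongrightarrow> 0"
  proof (rule tendstoI)
    fix e :: real assume e: "0 < e"
    obtain \<delta> where \<delta>: "0 < \<delta>"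
      "\<And>t v. \<lbrakk>t \<in> closure E; v \<in> closure E; 0 < t; t < \<delta>; Q * t \<le> v\<rbrakk> \<Longrightarrow> 1 / e * t < v"
      using eventually_avoids_window[where K = "1 / e", OF c Q(2)] by blast
    have "\<forall>\<^sub>F n in sequentially. l n < \<delta>" using order_tendstoD(2)[OF l0 \<delta>(1)] .
    then show "\<forall>\<^sub>F n in sequentially. dist (l n / m n) 0 < e"
    proof eventually_elim
      case (elim n)
      have "1 / e * l n < m n"
        using \<delta>(2)[OF gap_endpoints_in_closure[OF m(1)] Gpos[OF l(1)] elim m(2)] .
      moreover have "0 < l n" "0 < m n" using Gpos[OF l(1)] is_gapD[OF m(1)[of n]] by auto
      ultimately show ?case using e by (simp add: field_simps)
    qed
  qed
  have "L \<in> gap_seqs E"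
    using m(1) l(2) l0 ratio
    by (auto simp: gap_seqs_iff L_def intro!: almost_decreasingI less_imp_le)
  moreover have "gap_seq_le B L" if B: "B \<in> gap_seqs E" for B
  proof -
    obtain N where "\<And>n. N \<le> n \<Longrightarrow> fst (B n) \<in> G \<and> fst (B n) < l 0"
      using inG[OF B Gpos[OF l(1)]] unfolding eventually_sequentially by blast
    then have "\<forall>n. \<exists>k. N \<le> n \<longrightarrow> fst (B n) = l k" using covers by (meson less_imp_le)
    then obtain f where "\<And>n. N \<le> n \<Longrightarrow> fst (B n) = l (f n)" by metis
    then show ?thesis
      unfolding gap_seq_le_def L_def by (intro exI[of _ N] exI[of _ f]) simp
  qed
  ultimately show ?thesis unfolding universal_gap_seq_def by blast
qed

text \<open>Near zero, every positive point of \<open>E\<close> lies in some block \<open>[m (n + 1), l n]\<close>. If \<open>t \<in> E\<close> is in this block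
  and \<open>v / t\<close> stays bounded, then \<open>v\<close> cannot lie beyond the gap \<open>(l n, m n)\<close> above the block, whose ratio
  \<open>m n / l n\<close> is large; hence \<open>v / t \<le> l n / m (n + 1)\<close>.\<close>

lemma limit_ratio_le_gap_limsup:
  assumes s: "s \<in> limit_ratios E" and L: "L \<in> gap_seqs E"
  shows "ereal s \<le> gap_limsup L"
proof (rule ccontr)
  define l m where "l = (\<lambda>n. fst (L n))" and "m = (\<lambda>n. snd (L n))"
  have gap: "\<And>n. is_gap E (l n) (m n)"
    and L': "almost_decreasing l" "l \<longlonglongrightarrow> 0" "(\<lambda>n. l n / m n) \<longlonglongrightarrow> 0"
    using L by (auto simp: gap_seqs_iff l_def m_def)
  have lpos: "0 < l n" for n using gap_left_end_pos[OF limit_ratios_islimpt[OF s] gap] .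
  have lm: "l n < m n" for n using is_gapD(2)[OF gap] .
  have mpos: "0 < m n" for n using lpos[of n] lm[of n] by linarith
  assume "\<not> ereal s \<le> gap_limsup L"
  then obtain z where z: "gap_limsup L < ereal z" "z < s"
    using ereal_dense2[of "gap_limsup L" "ereal s"] by (auto simp: not_le)
  have "\<forall>\<^sub>F n in sequentially. ereal (l n / m (Suc n)) < ereal z"
    using Limsup_lessD[OF z(1)[unfolded gap_limsup_def]] by (simp add: l_def m_def)
  then have "\<forall>\<^sub>F n in sequentially. l n / m (Suc n) < z" by simp
  moreover have "\<forall>\<^sub>F n in sequentially. l n / m n < 1 / (\<bar>s\<bar> + 1)"
    using order_tendstoD(2)[OF L'(3)] by simp
  ultimately have "\<forall>\<^sub>F n in sequentially. l n / m (Suc n) < z \<and> l n / m n < 1 / (\<bar>s\<bar> + 1)"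
    by eventually_elim simp
  then obtain N where N: "\<And>n. N \<le> n \<Longrightarrow> l n / m (Suc n) < z \<and> l n / m n < 1 / (\<bar>s\<bar> + 1)"
    unfolding eventually_sequentially by blast
  obtain t v where tv: "t \<in> E" "v \<in> E" "0 < t" "t < l N" "\<bar>v / t - s\<bar> < min 1 (s - z)"
    using limit_ratiosD[OF s lpos[of N], of "min 1 (s - z)"] z(2) by auto
  have "\<exists>n. N \<le> n \<and> l (Suc n) < t"
  proof -
    have "\<forall>\<^sub>F n in sequentially. l n < t" using order_tendstoD(2)[OF L'(2) tv(3)] .
    then obtain i where "\<And>n. i \<le> n \<Longrightarrow> l n < t" unfolding eventually_sequentially by blast
    then show ?thesis by (intro exI[of _ "max i N"]) simp
  qed
  then obtain n where n: "N \<le> n" "l (Suc n) < t" "\<And>i. i < n \<Longrightarrow> \<not> (N \<le> i \<and> l (Suc i) < t)"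
    using exists_least_iff[of "\<lambda>n. N \<le> n \<and> l (Suc n) < t"] by blast
  have "t \<le> l n"
  proof (cases "n = N")
    case False
    then obtain i where "n = Suc i" "N \<le> i" using n(1) by (cases n) auto
    then show ?thesis using n(3)[of i] by auto
  qed (use tv in simp)
  have outside: "x \<le> l i \<or> m i \<le> x" if "x \<in> E" for x i
    using is_gapD(3)[OF gap[of i]] that closure_subset[of E] by force
  have "m (Suc n) \<le> t" using outside[OF tv(1), of "Suc n"] n(2) by simp
  show False
    using outside[OF tv(2), of n]
  proof
    assume "v \<le> l n"
    then have "v / t \<le> l n / m (Suc n)"
      using \<open>m (Suc n) \<le> t\<close> mpos[of "Suc n"] lpos[of n] by (intro frac_le) auto
    then show False using N[OF n(1)] tv(5) by linarith
  next
    assume "m n \<le> v"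
    have "(\<bar>s\<bar> + 1) * l n < m n" using N[OF n(1)] mpos[of n] by (simp add: field_simps)
    moreover have "(\<bar>s\<bar> + 1) * t \<le> (\<bar>s\<bar> + 1) * l n"
      using \<open>t \<le> l n\<close> by (intro mult_left_mono) auto
    ultimately have "(\<bar>s\<bar> + 1) * t < v" using \<open>m n \<le> v\<close> by linarith
    then have "\<bar>s\<bar> + 1 < v / t" using tv(3) by (simp add: field_simps)
    then show False using tv(5) by linarith
  qed
qed

text \<open>If \<open>l n / m (n + 1)\<close> exceeded some \<open>z > c\<close> for infinitely many \<open>n\<close>, there would be gaps with left
  ends in \<open>[m (n + 1), z * m (n + 1)]\<close>, hence below \<open>l n\<close>, that form a gap sequence. As \<open>l\<close> is eventually
  decreasing and \<open>l (n + 1) < m (n + 1)\<close>, these left ends do not occur in \<open>L\<close> close to zero, which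
  contradicts universality.\<close>

lemma universal_gap_limsup_le:
  assumes c: "\<And>s. s \<in> limit_ratios E \<Longrightarrow> s \<le> c" and lim: "0 islimpt E"
    and L: "universal_gap_seq E L"
  shows "gap_limsup L \<le> ereal c"
proof (rule ccontr)
  define l m where "l = (\<lambda>n. fst (L n))" and "m = (\<lambda>n. snd (L n))"
  have "L \<in> gap_seqs E" using L by (simp add: universal_gap_seq_def)
  then have gap: "\<And>n. is_gap E (l n) (m n)"
    and L': "almost_decreasing l" "l \<longlonglongrightarrow> 0"
    by (auto simp: gap_seqs_iff l_def m_def)
  have lpos: "0 < l n" for n using gap_left_end_pos[OF lim gap] .
  have lm: "l n < m n" for n using is_gapD(2)[OF gap] .
  have mpos: "0 < m n" for n using lpos[of n] lm[of n] by linarith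
  have "1 \<le> c" using c[OF one_in_limit_ratios[OF lim]] .
  assume "\<not> gap_limsup L \<le> ereal c"
  then obtain z where z: "c < z" "ereal z < gap_limsup L"
    using ereal_dense2[of "ereal c" "gap_limsup L"] by (auto simp: not_le)
  have frequent: "\<exists>n\<ge>k. z * m (Suc n) < l n" for k
  proof (rule ccontr)
    assume none: "\<not> (\<exists>n\<ge>k. z * m (Suc n) < l n)"
    have "l n / m (Suc n) \<le> z" if "k \<le> n" for n
      using none that mpos[of "Suc n"] by (auto simp: divide_le_eq not_less)
    then have "\<forall>\<^sub>F n in sequentially. ereal (fst (L n) / snd (L (Suc n))) \<le> ereal z"
      unfolding eventually_sequentially l_def m_def by auto
    then have "gap_limsup L \<le> ereal z" unfolding gap_limsup_def by (rule Limsup_bounded)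
    then show False using z(2) by simp
  qed
  have choice: "\<exists>n. 0 < m (Suc n) \<and> m (Suc n) < e \<and> (k \<le> n \<and> z * m (Suc n) < l n)"
    if e: "0 < e" for k e
  proof -
    obtain N where N: "\<And>n. N \<le> n \<Longrightarrow> l n < e"
      using order_tendstoD(2)[OF L'(2) e] unfolding eventually_sequentially by blast
    obtain n where n: "max N k \<le> n" "z * m (Suc n) < l n" using frequent by blast
    have "1 * m (Suc n) \<le> z * m (Suc n)"
      using \<open>1 \<le> c\<close> z(1) mpos[of "Suc n"] by (intro mult_right_mono) auto
    then have "m (Suc n) < e" using n N[of n] by simp
    then show ?thesis using n mpos by auto
  qed
  from decreasing_null_choice[where f = "\<lambda>n. m (Suc n)" and
      Q = "\<lambda>k n. k \<le> n \<and> z * m (Suc n) < l n", OF choice]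
  obtain n where n: "\<And>k. k \<le> n k" "\<And>k. z * m (Suc (n k)) < l (n k)"
      "\<And>k. m (Suc (n (Suc k))) < m (Suc (n k))" "(\<lambda>k. m (Suc (n k))) \<longlonglongrightarrow> 0"
    by blast
  define t where "t = (\<lambda>k. m (Suc (n k)))"
  have t: "t k \<in> closure E" "0 < t k" "almost_decreasing t" "t \<longlonglongrightarrow> 0" for k
    using n(3,4) mpos gap_endpoints_in_closure(2)[OF gap]
    by (auto simp: t_def intro!: almost_decreasingI less_imp_le)
  have "1 \<le> z" using \<open>1 \<le> c\<close> z(1) by simp
  obtain A where A: "A \<in> gap_seqs E"
      "\<forall>\<^sub>F k in sequentially. t k \<le> fst (A k) \<and> fst (A k) \<le> z * t k"
    using gap_seq_above_sequence[where t = t, OF c z(1) \<open>1 \<le> z\<close> t] by blast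
  obtain N f where f: "\<And>k. N \<le> k \<Longrightarrow> fst (A k) = l (f k)"
    using L A(1) unfolding universal_gap_seq_def gap_seq_le_def l_def by blast
  obtain N' where dec: "\<And>i j. \<lbrakk>N' \<le> i; i \<le> j\<rbrakk> \<Longrightarrow> l j \<le> l i"
    using almost_decreasingE[OF L'(1)] by blast
  \<comment> \<open>For large \<open>k\<close>, \<open>f k\<close> lies beyond \<open>N'\<close>, where \<open>l\<close> is decreasing.\<close>
  define \<mu> where "\<mu> = Min (l ` {..N'})"
  have "0 < \<mu>" unfolding \<mu>_def using lpos by (subst Min_gr_iff) auto
  moreover have "(\<lambda>k. fst (A k)) \<longlonglongrightarrow> 0" using A(1) by (simp add: gap_seqs_iff)
  ultimately have "\<forall>\<^sub>F k in sequentially. fst (A k) < \<mu>" by (rule order_tendstoD(2)[rotated])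
  then have "\<forall>\<^sub>F k in sequentially. fst (A k) < \<mu> \<and> N \<le> k \<and> N' \<le> k \<and>
      t k \<le> fst (A k) \<and> fst (A k) \<le> z * t k"
    using A(2) eventually_ge_at_top[of N] eventually_ge_at_top[of N'] by eventually_elim simp
  then obtain k where k: "fst (A k) < \<mu>" "N \<le> k" "N' \<le> k" "t k \<le> fst (A k)" "fst (A k) \<le> z * t k"
    using eventually_happens'[OF sequentially_bot] by blast
  have "N' < f k"
  proof (rule ccontr)
    assume "\<not> N' < f k"
    then have "\<mu> \<le> l (f k)" unfolding \<mu>_def by (intro Min_le) auto
    then show False using k(1) f[OF k(2)] by simp
  qed
  have "l (f k) < l (n k)" using k(5) n(2)[of k] f[OF k(2)] by (simp add: t_def)
  then have "n k < f k"
    using dec[of "f k" "n k"] \<open>N' < f k\<close> by (meson leD less_imp_le not_less)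
  then have "l (f k) \<le> l (Suc (n k))" using dec[of "Suc (n k)" "f k"] k(3) n(1)[of k] by simp
  also have "\<dots> < t k" unfolding t_def by (rule lm)
  also have "\<dots> \<le> l (f k)" using k(4) f[OF k(2)] by simp
  finally show False by simp
qed

theorem universal_gap_limsup_eq_Sup_limit_ratios:
  assumes c: "\<And>s. s \<in> limit_ratios E \<Longrightarrow> s \<le> c" and lim: "0 islimpt E"
    and L: "universal_gap_seq E L"
  shows "gap_limsup L = (SUP s\<in>limit_ratios E. ereal s)"
proof (rule antisym)
  let ?S = "SUP s\<in>limit_ratios E. ereal s"
  have "?S \<le> ereal c" using c by (auto intro: SUP_least)
  moreover have "ereal 1 \<le> ?S" using one_in_limit_ratios[OF lim] by (rule SUP_upper)
  ultimately obtain c' where c': "?S = ereal c'" by (cases ?S) auto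
  have "s \<le> c'" if "s \<in> limit_ratios E" for s
    using SUP_upper[OF that, of ereal] c' by simp
  then show "gap_limsup L \<le> ?S" using universal_gap_limsup_le[OF _ lim L] c' by simp
  show "?S \<le> gap_limsup L"
    using L limit_ratio_le_gap_limsup by (auto simp: universal_gap_seq_def intro: SUP_least)
qed

end

section \<open>Distances in pretangent spaces\<close>

context Metric_space
begin

lemma self_stable_tendsto:
  assumes "self_stable M d r F" "x \<in> F" "y \<in> F"
  shows "(\<lambda>n. d (x n) (y n) / r n) \<longlonglongrightarrow> scaled_dist d r x y"
  using assms by (simp add: self_stable_def mutually_stable_def scaled_dist_def convergent_LIMSEQ_iff)

lemma mutually_stable_refl: "x \<in> point_seqs M \<Longrightarrow> mutually_stable d r x x"
  by (simp add: mutually_stable_def point_seqs_def convergent_const)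

lemma mutually_stable_sym: "mutually_stable d r x y \<longleftrightarrow> mutually_stable d r y x"
  by (simp add: mutually_stable_def commute)

lemma self_stable_insert_iff:
  "self_stable M d r (insert z F) \<longleftrightarrow>
     self_stable M d r F \<and> z \<in> point_seqs M \<and> (\<forall>x\<in>F. mutually_stable d r z x)"
  using mutually_stable_refl[of z r] mutually_stable_sym[of r z] unfolding self_stable_def by blast

lemma maximal_self_stable_extension:
  assumes "self_stable M d r F\<^sub>0"
  obtains F where "maximal_self_stable M d r F" "F\<^sub>0 \<subseteq> F"
proof -
  let ?\<A> = "{F. self_stable M d r F \<and> F\<^sub>0 \<subseteq> F}"
  have "\<exists>F\<in>?\<A>. \<forall>G\<in>?\<A>. F \<subseteq> G \<longrightarrow> G = F"
  proof (rule subset_Zorn_nonempty)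
    show "?\<A> \<noteq> {}" using assms by blast
    fix \<C> assume \<C>: "\<C> \<noteq> {}" "subset.chain ?\<A> \<C>"
    have mem: "A \<subseteq> point_seqs M" "\<forall>x\<in>A. \<forall>y\<in>A. mutually_stable d r x y" "F\<^sub>0 \<subseteq> A"
      if "A \<in> \<C>" for A
      using \<C>(2) that by (auto simp: subset_chain_def self_stable_def)
    have "mutually_stable d r x y" if "x \<in> A" "A \<in> \<C>" "y \<in> B" "B \<in> \<C>" for x y A B
    proof -
      have "A \<subseteq> B \<or> B \<subseteq> A" using \<C>(2) that unfolding subset_chain_def by blast
      then show ?thesis using mem(2)[OF that(2)] mem(2)[OF that(4)] that by blast
    qed
    moreover have "\<Union>\<C> \<subseteq> point_seqs M" using mem(1) by (rule Union_least)
    moreover have "F\<^sub>0 \<subseteq> \<Union>\<C>" using mem(3) \<C>(1) by blast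
    ultimately show "\<Union>\<C> \<in> ?\<A>" by (simp add: self_stable_def)
  qed
  then obtain F where F: "self_stable M d r F" "F\<^sub>0 \<subseteq> F"
    and max: "\<forall>G\<in>?\<A>. F \<subseteq> G \<longrightarrow> G = F" by blast
  have "\<exists>x\<in>F. \<not> mutually_stable d r z x" if z: "z \<in> point_seqs M - F" for z
  proof (rule ccontr)
    assume "\<not> (\<exists>x\<in>F. \<not> mutually_stable d r z x)"
    then have "insert z F \<in> ?\<A>" using F z by (simp add: self_stable_insert_iff) blast
    then have "insert z F = F" using max by blast
    then show False using z by blast
  qed
  with F(1) have "maximal_self_stable M d r F" unfolding maximal_self_stable_def by blast
  then show thesis using F(2) by (rule that)
qed

lemma scaled_dist_commute: "scaled_dist d r x y = scaled_dist d r y x"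
  by (simp add: scaled_dist_def commute)

lemma scaled_dist_self: "scaled_dist d r x x = 0" if "x \<in> point_seqs M"
  using that by (simp add: scaled_dist_def point_seqs_def)

lemma scaled_dist_triangle:
  assumes F: "self_stable M d r F" and r: "\<And>n. 0 < r n" and xyz: "x \<in> F" "y \<in> F" "z \<in> F"
  shows "scaled_dist d r x z \<le> scaled_dist d r x y + scaled_dist d r y z"
proof (rule LIMSEQ_le)
  show "(\<lambda>n. d (x n) (z n) / r n) \<longlonglongrightarrow> scaled_dist d r x z"
    using self_stable_tendsto[OF F] xyz by blast
  show "(\<lambda>n. d (x n) (y n) / r n + d (y n) (z n) / r n) \<longlonglongrightarrow>
      scaled_dist d r x y + scaled_dist d r y z"
    using self_stable_tendsto[OF F] xyz by (intro tendsto_add) auto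
  have "d (x n) (z n) / r n \<le> d (x n) (y n) / r n + d (y n) (z n) / r n" for n
  proof -
    have "x n \<in> M" "y n \<in> M" "z n \<in> M"
      using F xyz by (auto simp: self_stable_def point_seqs_def)
    then show ?thesis
      using triangle r[of n] by (simp add: add_divide_distrib[symmetric] divide_right_mono)
  qed
  then show "\<exists>N. \<forall>n\<ge>N. d (x n) (z n) / r n \<le> d (x n) (y n) / r n + d (y n) (z n) / r n"
    by blast
qed

lemma quotient_dist_of_classes:
  assumes F: "self_stable M d r F" and r: "\<And>n. 0 < r n" and xy: "x \<in> F" "y \<in> F"
  shows "quotient_dist d r (zero_dist_rel d r F `` {x}) (zero_dist_rel d r F `` {y}) =
    scaled_dist d r x y"
proof -
  let ?s = "scaled_dist d r"
  have eq: "?s x' y' = ?s x y"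
    if "(x, x') \<in> zero_dist_rel d r F" "(y, y') \<in> zero_dist_rel d r F" for x' y'
  proof -
    have F': "x' \<in> F" "y' \<in> F" and 0: "?s x x' = 0" "?s y y' = 0"
      using that by (auto simp: zero_dist_rel_def)
    note tri = scaled_dist_triangle[OF F r]
    have "?s x' y' \<le> ?s x' x + (?s x y + ?s y y')" "?s x y \<le> ?s x x' + (?s x' y' + ?s y' y)"
      using tri[of x' x y'] tri[of x y y'] tri[of x x' y] tri[of x' y' y] F' xy by auto
    then show ?thesis
      using 0 scaled_dist_commute[of r x' x] scaled_dist_commute[of r y' y] by simp
  qed
  have "(x, x) \<in> zero_dist_rel d r F" "(y, y) \<in> zero_dist_rel d r F"
    using F xy scaled_dist_self by (auto simp: zero_dist_rel_def self_stable_def)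
  then have "(\<Union>x'\<in>zero_dist_rel d r F `` {x}. \<Union>y'\<in>zero_dist_rel d r F `` {y}. {?s x' y'}) = {?s x y}"
    using eq by blast
  then show ?thesis by (simp add: quotient_dist_def)
qed

lemma quotient_eq_classes: "F // R = (\<lambda>x. R `` {x}) ` F"
  by (auto simp: quotient_def)

lemma space_radius_metric_identification:
  assumes "self_stable M d r F" "\<And>n. 0 < r n" "(\<lambda>n. p) \<in> F"
  shows "space_radius (metric_identification d p r F) =
    (SUP x\<in>F. ereal (scaled_dist d r x (\<lambda>n. p)))"
  using quotient_dist_of_classes[OF assms(1,2)] assms(3)
  by (auto simp: space_radius_def metric_identification_def quotient_eq_classes image_image
      intro!: SUP_cong)

lemma space_diameter_metric_identification:
  assumes "self_stable M d r F" "\<And>n. 0 < r n"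
  shows "space_diameter (metric_identification d p r F) =
    (SUP (x, y)\<in>F \<times> F. ereal (scaled_dist d r x y))"
proof -
  let ?c = "\<lambda>x. zero_dist_rel d r F `` {x}"
  have "F // zero_dist_rel d r F \<times> F // zero_dist_rel d r F = (\<lambda>(x, y). (?c x, ?c y)) ` (F \<times> F)"
    by (auto simp: quotient_eq_classes)
  then show ?thesis
    using quotient_dist_of_classes[OF assms]
    by (auto simp: space_diameter_def metric_identification_def image_image case_prod_unfold
        intro!: SUP_cong)
qed

lemma dist_set_nonneg_with_zero: "p \<in> M \<Longrightarrow> nonneg_set_with_zero (dist_set M d p)"
  unfolding nonneg_set_with_zero_def dist_set_def by force

lemma derived_set_iff_islimpt_dist_set:
  assumes "p \<in> M"
  shows "p \<in> mtopology derived_set_of M \<longleftrightarrow> 0 islimpt dist_set M d p"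
proof -
  have "(\<exists>y\<in>M. y \<noteq> p \<and> y \<in> mball p e) \<longleftrightarrow> (\<exists>s\<in>dist_set M d p. s \<noteq> 0 \<and> dist s 0 < e)" for e
  proof -
    have "y \<noteq> p \<and> y \<in> mball p e \<longleftrightarrow> d y p \<noteq> 0 \<and> dist (d y p) 0 < e" if "y \<in> M" for y
      using assms that by (auto simp: commute)
    then show ?thesis unfolding dist_set_def by blast
  qed
  then show ?thesis using assms by (simp add: metric_derived_set_of islimpt_approachable)
qed

text \<open>For a normal scaling \<open>r\<close> the sequence \<open>r n\<close> may be replaced by distances \<open>t n\<close> of points from
  \<open>p\<close>, so distances from the marked point are limits of ratios \<open>v n / t n\<close>.\<close>

lemma scaled_dist_in_limit_ratios:
  assumes p: "p \<in> M" and r: "normal_scaling_seq M d p r"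
    and F: "self_stable M d r F" "(\<lambda>n. p) \<in> F" "x \<in> F"
  shows "scaled_dist d r x (\<lambda>n. p) \<in> limit_ratios (dist_set M d p)"
proof -
  obtain y where y: "y \<in> point_seqs M" "(\<lambda>n. d (y n) p / r n) \<longlonglongrightarrow> 1"
    using r by (auto simp: normal_scaling_seq_def)
  have rpos: "\<And>n. 0 < r n" and r0: "r \<longlonglongrightarrow> 0"
    using r by (auto simp: normal_scaling_seq_def scaling_seq_def)
  have xM: "x \<in> point_seqs M" using F by (auto simp: self_stable_def)
  show ?thesis
  proof (rule limit_ratiosI_sequence)
    show "d (y n) p \<in> dist_set M d p" "d (x n) p \<in> dist_set M d p" for n
      using y(1) xM by (auto simp: dist_set_def point_seqs_def)
    have "\<forall>\<^sub>F n in sequentially. 0 < d (y n) p / r n"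
      using order_tendstoD(1)[OF y(2)] by simp
    then show "\<forall>\<^sub>F n in sequentially. 0 < d (y n) p"
      by eventually_elim (use rpos less_asym in \<open>auto simp: zero_less_divide_iff\<close>)
    have eq: "d (y n) p / r n * r n = d (y n) p" for n using less_imp_neq[OF rpos[of n]] by simp
    show "(\<lambda>n. d (y n) p) \<longlonglongrightarrow> 0"
      using tendsto_mult[OF y(2) r0] by (simp only: eq mult_zero_right)
    have "(\<lambda>n. (d (x n) p / r n) / (d (y n) p / r n)) \<longlonglongrightarrow> scaled_dist d r x (\<lambda>n. p) / 1"
      using self_stable_tendsto[OF F(1,3,2)] y(2) by (intro tendsto_divide) auto
    then show "(\<lambda>n. d (x n) p / d (y n) p) \<longlonglongrightarrow> scaled_dist d r x (\<lambda>n. p)"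
      using less_imp_neq[OF rpos] by simp
  qed
qed

text \<open>Conversely, let \<open>v n / t n\<close> tend to \<open>s\<close> with \<open>t\<close> decreasing. Then \<open>t\<close> itself is a normal scaling
  sequence, and points at distance \<open>v n\<close> from \<open>p\<close> form a self-stable pair with the constant sequence
  at \<open>p\<close>.\<close>

lemma limit_ratio_realised:
  assumes p: "p \<in> M" and s: "s \<in> limit_ratios (dist_set M d p)"
  obtains r F x where "normal_scaling_seq M d p r" "maximal_self_stable M d r F"
    "(\<lambda>n. p) \<in> F" "x \<in> F" "scaled_dist d r x (\<lambda>n. p) = s"
proof -
  interpret D: nonneg_set_with_zero "dist_set M d p" using dist_set_nonneg_with_zero[OF p] .
  obtain t v where t: "t \<in> decreasing_seqs (dist_set M d p)"
    and v: "\<And>n. v n \<in> dist_set M d p" and lim: "(\<lambda>n. v n / t n) \<longlonglongrightarrow> s"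
    using limit_ratiosE_sequence[OF s] by metis
  note t' = D.decreasing_seqsD[OF t]
  have "\<forall>n. \<exists>y\<in>M. d y p = t n" "\<forall>n. \<exists>x\<in>M. d x p = v n"
    using t v by (auto simp: decreasing_seqs_def dist_set_def) metis+
  then obtain y x where y: "\<And>n. y n \<in> M" "\<And>n. d (y n) p = t n"
    and x: "\<And>n. x n \<in> M" "\<And>n. d (x n) p = v n" by metis
  have normal: "normal_scaling_seq M d p t"
    unfolding normal_scaling_seq_def
  proof (intro conjI bexI)
    show "scaling_seq t" using t' by (simp add: scaling_seq_def)
    show "p \<in> mtopology derived_set_of M"
      using D.limit_ratios_islimpt[OF s] derived_set_iff_islimpt_dist_set[OF p] by simp
    show "almost_decreasing (\<lambda>n. d (y n) p)" using t' y by simp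
    have "d (y n) p / t n = 1" for n using y(2) t'(2)[of n] by simp
    then show "(\<lambda>n. d (y n) p / t n) \<longlonglongrightarrow> 1" by (simp only: tendsto_const)
  qed (use y in \<open>simp add: point_seqs_def\<close>)
  have lim': "(\<lambda>n. d (x n) p / t n) \<longlonglongrightarrow> s" using lim x by simp
  have "self_stable M d t {x, \<lambda>n. p}"
    using p x lim' convergentI mutually_stable_refl
    by (auto simp: self_stable_insert_iff self_stable_def[of _ _ _ "{}"] point_seqs_def
        mutually_stable_def)
  then obtain F where F: "maximal_self_stable M d t F" "{x, \<lambda>n. p} \<subseteq> F"
    by (rule maximal_self_stable_extension)
  have "scaled_dist d t x (\<lambda>n. p) = s" using limI[OF lim'] by (simp add: scaled_dist_def)
  then show thesis using that normal F by blast
qed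

lemma family_radius_eq_Sup_limit_ratios:
  assumes p: "p \<in> M"
  shows "family_radius (normal_pretangent_spaces M d p) =
    (SUP s\<in>limit_ratios (dist_set M d p). ereal s)"
proof (rule antisym)
  show "family_radius (normal_pretangent_spaces M d p) \<le>
      (SUP s\<in>limit_ratios (dist_set M d p). ereal s)"
    unfolding family_radius_def
  proof (rule SUP_least)
    fix T assume "T \<in> normal_pretangent_spaces M d p"
    then obtain r F where T: "T = metric_identification d p r F" "normal_scaling_seq M d p r"
        "maximal_self_stable M d r F" "(\<lambda>n. p) \<in> F"
      by (auto simp: normal_pretangent_spaces_def)
    have F: "self_stable M d r F" and r: "\<And>n. 0 < r n"
      using T by (auto simp: maximal_self_stable_def normal_scaling_seq_def scaling_seq_def)
    show "space_radius T \<le> (SUP s\<in>limit_ratios (dist_set M d p). ereal s)"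
      unfolding T(1) space_radius_metric_identification[OF F r T(4)]
      by (intro SUP_least SUP_upper scaled_dist_in_limit_ratios[OF p T(2) F T(4)])
  qed
next
  show "(SUP s\<in>limit_ratios (dist_set M d p). ereal s) \<le>
      family_radius (normal_pretangent_spaces M d p)"
  proof (rule SUP_least)
    fix s assume "s \<in> limit_ratios (dist_set M d p)"
    then obtain r F x where T: "normal_scaling_seq M d p r" "maximal_self_stable M d r F"
        "(\<lambda>n. p) \<in> F" "x \<in> F" "scaled_dist d r x (\<lambda>n. p) = s"
      by (rule limit_ratio_realised[OF p])
    have F: "self_stable M d r F" and r: "\<And>n. 0 < r n"
      using T by (auto simp: maximal_self_stable_def normal_scaling_seq_def scaling_seq_def)
    have "ereal s \<le> space_radius (metric_identification d p r F)"
      unfolding space_radius_metric_identification[OF F r T(3)] T(5)[symmetric]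
      using T(4) by (rule SUP_upper)
    also have "\<dots> \<le> family_radius (normal_pretangent_spaces M d p)"
      unfolding family_radius_def
      by (rule SUP_upper) (use T in \<open>auto simp: normal_pretangent_spaces_def\<close>)
    finally show "ereal s \<le> family_radius (normal_pretangent_spaces M d p)" .
  qed
qed

lemma uniformly_bounded_iff_limit_ratios_bounded:
  assumes p: "p \<in> M"
  shows "uniformly_bounded (normal_pretangent_spaces M d p) \<longleftrightarrow>
    (\<exists>c. \<forall>s\<in>limit_ratios (dist_set M d p). s \<le> c)"
proof
  assume "uniformly_bounded (normal_pretangent_spaces M d p)"
  then obtain c where c: "\<And>T. T \<in> normal_pretangent_spaces M d p \<Longrightarrow> space_diameter T < ereal c"
    by (auto simp: uniformly_bounded_def)
  have "s \<le> c" if s: "s \<in> limit_ratios (dist_set M d p)" for s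
  proof -
    obtain r F x where T: "normal_scaling_seq M d p r" "maximal_self_stable M d r F"
        "(\<lambda>n. p) \<in> F" "x \<in> F" "scaled_dist d r x (\<lambda>n. p) = s"
      by (rule limit_ratio_realised[OF p s])
    have F: "self_stable M d r F" and r: "\<And>n. 0 < r n"
      using T by (auto simp: maximal_self_stable_def normal_scaling_seq_def scaling_seq_def)
    have "(x, \<lambda>n. p) \<in> F \<times> F" using T by simp
    then have "ereal s \<le> space_diameter (metric_identification d p r F)"
      unfolding space_diameter_metric_identification[OF F r] T(5)[symmetric]
      by (rule SUP_upper2) simp
    also have "\<dots> < ereal c"
      by (rule c) (use T in \<open>auto simp: normal_pretangent_spaces_def\<close>)
    finally show ?thesis by simp
  qed
  then show "\<exists>c. \<forall>s\<in>limit_ratios (dist_set M d p). s \<le> c" by blast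
next
  assume "\<exists>c. \<forall>s\<in>limit_ratios (dist_set M d p). s \<le> c"
  then obtain c where c: "\<And>s. s \<in> limit_ratios (dist_set M d p) \<Longrightarrow> s \<le> c" by blast
  have "space_diameter T < ereal (2 * \<bar>c\<bar> + 1)" if T_in: "T \<in> normal_pretangent_spaces M d p" for T
  proof -
    obtain r F where T: "T = metric_identification d p r F" "normal_scaling_seq M d p r"
        "maximal_self_stable M d r F" "(\<lambda>n. p) \<in> F"
      using T_in by (auto simp: normal_pretangent_spaces_def)
    have F: "self_stable M d r F" and r: "\<And>n. 0 < r n"
      using T by (auto simp: maximal_self_stable_def normal_scaling_seq_def scaling_seq_def)
    have radius: "scaled_dist d r x (\<lambda>n. p) \<le> c" if "x \<in> F" for x
      using c scaled_dist_in_limit_ratios[OF p T(2) F T(4) that] by blast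
    have "scaled_dist d r x y \<le> 2 * \<bar>c\<bar>" if "x \<in> F" "y \<in> F" for x y
      using scaled_dist_triangle[OF F r that(1) T(4) that(2)] radius[OF that(1)] radius[OF that(2)]
        scaled_dist_commute[of r y "\<lambda>n. p"] by linarith
    then have "space_diameter T \<le> ereal (2 * \<bar>c\<bar>)"
      unfolding T(1) space_diameter_metric_identification[OF F r] by (auto intro: SUP_least)
    also have "\<dots> < ereal (2 * \<bar>c\<bar> + 1)" by simp
    finally show ?thesis .
  qed
  then show "uniformly_bounded (normal_pretangent_spaces M d p)"
    unfolding uniformly_bounded_def by (intro exI[of _ "2 * \<bar>c\<bar> + 1"]) auto
qed

end

theorem theorem3p11:
  fixes X :: "'a set" and d :: "'a \<Rightarrow> 'a \<Rightarrow> real" and p :: 'a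
  assumes "Metric_space X d" and "p \<in> X"
  shows "(uniformly_bounded (normal_pretangent_spaces X d p) \<longleftrightarrow>
            completely_strongly_porous (dist_set X d p)) \<and>
         (uniformly_bounded (normal_pretangent_spaces X d p) \<and>
            p \<in> Metric_space.mtopology X d derived_set_of X \<longrightarrow>
            (\<exists>L. universal_gap_seq (dist_set X d p) L) \<and>
            (\<forall>L. universal_gap_seq (dist_set X d p) L \<longrightarrow>
               family_radius (normal_pretangent_spaces X d p) = gap_limsup L))"
proof -
  interpret Metric_space X d by fact
  interpret D: nonneg_set_with_zero "dist_set X d p"
    using dist_set_nonneg_with_zero[OF \<open>p \<in> X\<close>] .
  note bounded_iff = uniformly_bounded_iff_limit_ratios_bounded[OF \<open>p \<in> X\<close>]
  show ?thesis
  proof (intro conjI impI)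
    show "uniformly_bounded (normal_pretangent_spaces X d p) \<longleftrightarrow>
        completely_strongly_porous (dist_set X d p)"
      using bounded_iff D.completely_strongly_porous_iff_limit_ratios_bounded by simp
  next
    assume *: "uniformly_bounded (normal_pretangent_spaces X d p) \<and>
      p \<in> mtopology derived_set_of X"
    then obtain c where c: "\<And>s. s \<in> limit_ratios (dist_set X d p) \<Longrightarrow> s \<le> c"
      using bounded_iff by blast
    have lim: "0 islimpt dist_set X d p"
      using * derived_set_iff_islimpt_dist_set[OF \<open>p \<in> X\<close>] by blast
    show "\<exists>L. universal_gap_seq (dist_set X d p) L"
      by (rule D.universal_gap_seq_exists[OF c lim])
    show "\<forall>L. universal_gap_seq (dist_set X d p) L \<longrightarrow>
        family_radius (normal_pretangent_spaces X d p) = gap_limsup L"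
      using D.universal_gap_limsup_eq_Sup_limit_ratios[OF c lim]
        family_radius_eq_Sup_limit_ratios[OF \<open>p \<in> X\<close>] by simp
  qed
qed

end
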